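(* Let $h : S_1 \to S_1$ be an orientation preserving homeomorphism for which $h(\mathbf{Z}[\frac{1}{2}]) = \mathbf{Z}[\frac{1}{2}]$, and assume that $h\nu_2 h^{-1}$ and $h^{-1}\nu_2 h$ are both in $\overline{T}_{2,1}$. Then $h$ is piecewise linear.
   Context: $S_1=\mathbf{R}/\mathbf{Z}$; linearity, slope, etc. of functions on $S_1$ are understood exactly as on $\mathbf{R}$. $\mathbf{Z}[\frac12]$ denotes the set of points of $S_1$ represented by numbers $a2^b$, $a,b\in\mathbf{Z}$. The map $\nu_2:S_1\to S_1$ is $\nu_2(x)=2x$. A break of $f$ is a point of discontinuity of $f'$. A continuous function is piecewise linear (PL) if each point of its domain has an open neighborhood on which it is at most the only break. $\overline T_{2,1}$ is the monoid of functions $f$ whose domain and range are open subsets of $S_1$ and which satisfy: (1) $f$ is PL; (2) $f$ is locally an orientation preserving homeomorphism (not necessarily injective globally); (3) all slopes of $f$ are integral powers of $2$; (4) the breaks of $f$ lie in $\mathbf{Z}[\frac12]$ and are discrete in the domain of $f$; (5) $f$ maps points of $\mathbf{Z}[\frac12]$ in its domain into $\mathbf{Z}[\frac12]$. For instance $\nu_2\in\overline T_{2,1}$. *)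

theory Defs
  imports "HOL-Analysis.Analysis"
begin

quotient_type circle = real / "\<lambda>x y :: real. x - y \<in> \<int>"
proof (rule equivpI)
  show "reflp (\<lambda>x y :: real. x - y \<in> \<int>)"
    by (auto simp: reflp_def)
  show "symp (\<lambda>x y :: real. x - y \<in> \<int>)"
  proof (rule sympI)
    fix x y :: real
    assume "x - y \<in> \<int>"
    then have "- (x - y) \<in> \<int>"
      by (rule Ints_minus)
    then show "y - x \<in> \<int>"
      by simp
  qed
  show "transp (\<lambda>x y :: real. x - y \<in> \<int>)"
  proof (rule transpI)
    fix x y z :: real
    assume "x - y \<in> \<int>" "y - z \<in> \<int>"
    then have "(x - y) + (y - z) \<in> \<int>"
      by (rule Ints_add)
    then show "x - z \<in> \<int>"
      by simp
  qed
qed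

lift_definition to_circle :: "real \<Rightarrow> circle" is "\<lambda>t. t" .

instantiation circle :: topological_space
begin

definition open_circle :: "circle set \<Rightarrow> bool" where
  "open_circle U \<longleftrightarrow> open (to_circle -` U)"

instance
proof
  show "open (UNIV :: circle set)"
    by (simp add: open_circle_def)
  show "open (U \<inter> V)" if "open U" "open V" for U V :: "circle set"
    using that by (simp add: open_circle_def open_Int)
  show "open (\<Union>K)" if "\<forall>U\<in>K. open U" for K :: "circle set set"
    using that by (auto simp: open_circle_def vimage_Union)
qed

end

lift_definition nu2 :: "circle \<Rightarrow> circle" is "\<lambda>t. 2 * t"
proof -
  fix x y :: real
  assume "x - y \<in> \<int>"
  then have "2 * (x - y) \<in> \<int>"
    by (intro Ints_mult Ints_numeral)
  then show "2 * x - 2 * y \<in> \<int>"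
    by (simp add: right_diff_distrib)
qed

definition dyadic :: "circle set" where
  "dyadic = {to_circle (of_int a * 2 powi b) | a b :: int. True}"

text \<open>
  Local notions for maps of \<open>circle\<close> are read off from lifts: near \<open>t\<close> a lift of \<open>f\<close> is a real
  function \<open>F\<close> with \<open>f (to_circle s) = to_circle (F s)\<close>. Two lifts that are continuous at \<open>t\<close> differ near
  \<open>t\<close> by a constant integer, so none of the notions below depends on the choice of \<open>F\<close> or of the
  representative \<open>t\<close>. A partial map with open domain \<open>S\<close> is given by \<open>S\<close> together with a total
  function whose values outside \<open>S\<close> are irrelevant.
\<close>

definition orientation_preserving_on :: "circle set \<Rightarrow> (circle \<Rightarrow> circle) \<Rightarrow> bool" where
  "orientation_preserving_on S f \<longleftrightarrow>
     (\<forall>t. to_circle t \<in> S \<longrightarrow>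
        (\<exists>e>0. \<exists>F :: real \<Rightarrow> real.
            continuous_on {t - e<..<t + e} F \<and> strict_mono_on {t - e<..<t + e} F \<and>
            (\<forall>s\<in>{t - e<..<t + e}. f (to_circle s) = to_circle (F s))))"

definition has_slope :: "(circle \<Rightarrow> circle) \<Rightarrow> circle \<Rightarrow> real \<Rightarrow> bool" where
  "has_slope f x m \<longleftrightarrow>
     (\<exists>t F. x = to_circle t \<and> (\<forall>\<^sub>F s in nhds t. f (to_circle s) = to_circle (F s)) \<and>
            (F has_real_derivative m) (at t))"

text \<open>A point at which the derivative does not exist counts as a discontinuity of it.\<close>

definition is_break :: "(circle \<Rightarrow> circle) \<Rightarrow> circle \<Rightarrow> bool" where
  "is_break f x \<longleftrightarrow>
     \<not> (\<exists>f'. (\<forall>\<^sub>F y in nhds x. has_slope f y (f' y)) \<and> (f' \<longlongrightarrow> f' x) (at x))"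

definition linear_near :: "(circle \<Rightarrow> circle) \<Rightarrow> circle \<Rightarrow> bool" where
  "linear_near f x \<longleftrightarrow>
     (\<exists>t a b. x = to_circle t \<and> (\<forall>\<^sub>F s in nhds t. f (to_circle s) = to_circle (a * s + b)))"

text \<open>
  Absence of breaks alone would admit every continuously differentiable map, so linearity away from
  the possible break is required explicitly.
\<close>

definition PL_on :: "circle set \<Rightarrow> (circle \<Rightarrow> circle) \<Rightarrow> bool" where
  "PL_on S f \<longleftrightarrow>
     continuous_on S f \<and>
     (\<forall>x\<in>S. \<exists>V. open V \<and> x \<in> V \<and> V \<subseteq> S \<and>
        (\<forall>y\<in>V - {x}. \<not> is_break f y \<and> linear_near f y))"

definition local_orientation_preserving_homeo_on :: "circle set \<Rightarrow> (circle \<Rightarrow> circle) \<Rightarrow> bool" where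
  "local_orientation_preserving_homeo_on S f \<longleftrightarrow>
     (\<forall>x\<in>S. \<exists>V g. open V \<and> x \<in> V \<and> V \<subseteq> S \<and> open (f ` V) \<and>
        homeomorphism V (f ` V) f g \<and> orientation_preserving_on V f)"

text \<open>\<open>T21_bar S f\<close>: the partial map \<open>f\<close> with domain \<open>S\<close> belongs to the monoid
  \<open>T\<^sub>2\<^sub>,\<^sub>1\<close> (with a bar). The slope condition concerns every point at which the slope exists.\<close>

definition T21_bar :: "circle set \<Rightarrow> (circle \<Rightarrow> circle) \<Rightarrow> bool" where
  "T21_bar S f \<longleftrightarrow>
     open S \<and> open (f ` S) \<and>
     PL_on S f \<and>
     local_orientation_preserving_homeo_on S f \<and>
     (\<forall>x\<in>S. \<forall>m. has_slope f x m \<longrightarrow> (\<exists>k :: int. m = 2 powi k)) \<and>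
     {x\<in>S. is_break f x} \<subseteq> dyadic \<and>
     (\<forall>x\<in>S. \<not> x islimpt {x\<in>S. is_break f x}) \<and>
     f ` (S \<inter> dyadic) \<subseteq> dyadic"

end

theory Submission
  imports Defs
begin

text \<open>
  Lift \<open>h\<close> to an increasing homeomorphism \<open>H\<close> of the line. Conjugation by \<open>H\<close> and by its inverse sends
  the doubling map, hence also all dyadic translations, into the group \<open>PL2\<close>; so \<open>H\<close> normalises \<open>PL2\<close>,
  and near \<open>0\<close> (after a translation) it commutes with doubling. Rescaling by powers of \<open>2\<close> extends this
  germ to a homeomorphism \<open>\<phi>\<close> of the half line that commutes with doubling and conjugates dyadic
  translations to PL maps \<open>\<tau> q\<close>. It remains to show that \<open>\<phi>\<close> is linear.

  The logarithms of the slope jumps of \<open>\<tau> q\<close> form a cocycle that is invariant under doubling and, for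
  \<open>q = 1\<close>, finitely supported on \<open>(0, 1)\<close>. Such a cocycle is encoded by a function of the odd
  integers that is periodic modulo a power of \<open>2\<close>. If it is not trivial, then \<open>\<tau> q\<close> breaks in every gap
  of the grid generated by the power of \<open>2\<close> in \<open>q\<close>, and \<open>\<tau> 1\<close> breaks at points of arbitrarily large
  \<open>2\<close>-adic valuation. The first property, applied to the inverse of \<open>\<phi>\<close>, bounds the length of the affine
  pieces of \<open>\<tau> 1\<close> so that the \<open>2\<close>-adic valuations of its consecutive breaks stay below a fixed bound,
  which contradicts the second. A trivial cocycle forces \<open>\<phi>\<close> to be linear.
\<close>

subsection \<open>Dyadic numbers\<close>

text \<open>Finitely many breaks do not by themselves exclude a nontrivial cocycle: any function on
  the odd integers that is periodic modulo a power of \<open>2\<close>, extended by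
  \<open>J (2 * n) = J n + J 2\<close>, passes that test. The argument must use that the jumps come
  from an actual map, and it does so through a duality between \<open>\<phi>\<close> and its inverse
  \<open>\<psi>\<close>. If \<open>\<tau> 1\<close> is
  \<open>z \<mapsto> 2 powi i * (z + \<eta>)\<close> on an interval, then applying
  \<open>\<psi>\<close> gives \<open>\<psi> z + 1 = 2 powi i * \<psi> (z + \<eta>)\<close>, because
  \<open>\<psi>\<close> commutes with doubling and the slope comes out. Hence an affine piece of the
  translation by \<open>1\<close> seen through \<open>\<phi>\<close> is an affine piece of the
  translation by \<open>\<eta>\<close> seen through \<open>\<psi>\<close>, and the breaks belonging
  to \<open>\<psi>\<close> limit its length in terms of the valuation of \<open>\<eta>\<close>. This
  is why both maps satisfy the same axioms and why the valuation of \<open>\<eta>\<close> is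
  followed from one break to the next. Triviality of either cocycle suffices, since linearity passes
  to the inverse.\<close>

definition grid :: "int \<Rightarrow> real set" where
  "grid w = {of_int k * 2 powi w | k. True}"

definition Dy :: "real set" where
  "Dy = {of_int a * 2 powi b | a b :: int. True}"

lemma gridI: "x = of_int k * 2 powi w \<Longrightarrow> x \<in> grid w"
  by (auto simp: grid_def)

lemma gridE: assumes "x \<in> grid w" obtains k :: int where "x = of_int k * 2 powi w"
  using assms by (auto simp: grid_def)

lemma grid_subset_Dy: "x \<in> grid w \<Longrightarrow> x \<in> Dy"
  by (auto simp: grid_def Dy_def)

lemma DyE_grid: assumes "x \<in> Dy" obtains w where "x \<in> grid w"
  using assms by (auto simp: grid_def Dy_def)

lemma zero_in_grid [simp]: "0 \<in> grid w"
  by (rule gridI[of _ 0]) simp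

lemma powi2_nonneg_int:
  assumes "k \<ge> 0" shows "(2::real) powi k = of_int (2 ^ nat k)"
  using assms by (simp add: power_int_def)

lemma powi2_add: "(2::real) powi (a + b) = 2 powi a * 2 powi b"
  by (simp add: power_int_add)

lemma powi2_pos [simp]: "(0::real) < 2 powi k"
  by simp

lemma powi2_not_le [simp]: "\<not> (2::real) powi k \<le> 0" and powi2_not_less [simp]: "\<not> (2::real) powi k < 0"
  using powi2_pos[of k] by linarith+

lemma powi2_inj: "(2::real) powi i = 2 powi j \<longleftrightarrow> i = j"
proof
  assume eq: "(2::real) powi i = 2 powi j"
  show "i = j"
  proof (rule linorder_cases[of i j])
    assume "i < j" then have "(2::real) powi i < 2 powi j" by (rule power_int_strict_increasing) simp
    with eq show ?thesis by simp
  next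
    assume "j < i" then have "(2::real) powi j < 2 powi i" by (rule power_int_strict_increasing) simp
    with eq show ?thesis by simp
  qed
qed simp

lemma grid_mono: assumes "x \<in> grid v" "w \<le> v" shows "x \<in> grid w"
proof -
  obtain k where k: "x = of_int k * 2 powi v" using assms(1) by (rule gridE)
  have "(2::real) powi v = 2 powi (v - w) * 2 powi w" by (simp flip: powi2_add)
  also have "(2::real) powi (v - w) = of_int (2 ^ nat (v - w))" using assms(2) by (intro powi2_nonneg_int) simp
  finally show ?thesis using k by (intro gridI[of _ "k * 2 ^ nat (v - w)"]) simp
qed

lemma grid_add: "x \<in> grid w \<Longrightarrow> y \<in> grid w \<Longrightarrow> x + y \<in> grid w"
  by (elim gridE, rule gridI[of _ "_ + _"]) (simp add: ring_distribs)

lemma grid_uminus: "x \<in> grid w \<Longrightarrow> - x \<in> grid w"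
  by (elim gridE, rule gridI[of _ "- _"]) simp

lemma grid_scale: "x \<in> grid w \<Longrightarrow> 2 powi k * x \<in> grid (k + w)"
  by (elim gridE, rule gridI) (simp add: powi2_add)

lemma Dy_add: assumes "x \<in> Dy" "y \<in> Dy" shows "x + y \<in> Dy"
proof -
  obtain v w where "x \<in> grid v" "y \<in> grid w" using assms by (meson DyE_grid)
  then have "x \<in> grid (min v w)" "y \<in> grid (min v w)" by (auto intro: grid_mono)
  then show ?thesis by (intro grid_subset_Dy grid_add)
qed

lemma Dy_uminus: "x \<in> Dy \<Longrightarrow> - x \<in> Dy"
  by (erule DyE_grid) (rule grid_subset_Dy, rule grid_uminus)

lemma Dy_diff: "x \<in> Dy \<Longrightarrow> y \<in> Dy \<Longrightarrow> x - y \<in> Dy"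
  using Dy_add[of x "-y"] Dy_uminus[of y] by simp

lemma Dy_scale: "x \<in> Dy \<Longrightarrow> 2 powi k * x \<in> Dy"
  by (erule DyE_grid) (rule grid_subset_Dy, rule grid_scale)

lemma Dy_scale_iff [simp]: "2 powi k * x \<in> Dy \<longleftrightarrow> x \<in> Dy"
proof
  assume "2 powi k * x \<in> Dy"
  then have "2 powi (-k) * (2 powi k * x) \<in> Dy" by (rule Dy_scale)
  then show "x \<in> Dy" by (simp add: power_int_minus flip: mult.assoc)
qed (rule Dy_scale)

lemma Dy_of_int [simp]: "of_int n \<in> Dy"
  by (rule grid_subset_Dy[of _ 0]) (rule gridI[of _ n], simp)

lemma Dy_of_nat [simp]: "of_nat n \<in> Dy"
  using Dy_of_int[of "int n"] by simp

lemma Dy_0 [simp]: "0 \<in> Dy" and Dy_1 [simp]: "1 \<in> Dy"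
  using Dy_of_int[of 0] Dy_of_int[of 1] by simp_all

lemma Dy_add_iff: "d \<in> Dy \<Longrightarrow> x + d \<in> Dy \<longleftrightarrow> x \<in> Dy"
  using Dy_add[of x d] Dy_diff[of "x + d" d] by (auto simp del: Dy_scale_iff)

lemma Dy_odd:
  assumes "x \<in> Dy" "x \<noteq> 0"
  obtains p k :: int where "odd p" "x = of_int p * 2 powi k"
proof -
  obtain a b :: int where ab: "x = of_int a * 2 powi b" using assms(1) by (auto simp: Dy_def)
  have "a \<noteq> 0" using ab assms(2) by force
  have "\<exists>y. a = 2 ^ multiplicity 2 a * y \<and> \<not> 2 dvd y"
    by (rule multiplicity_decompose'[of a 2]) (use \<open>a \<noteq> 0\<close> in \<open>auto intro: exI\<close>)
  then obtain n p where p: "a = 2 ^ n * p" "\<not> 2 dvd p" by blast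
  have "x = of_int p * 2 powi (int n + b)" by (simp add: ab p powi2_add)
  then show ?thesis using that p(2) by blast
qed

text \<open>This lets \<open>grid\<close> stand in for the 2-adic valuation: \<open>grid w\<close>
  collects the numbers of valuation at least \<open>w\<close>, together with
  \<open>0\<close>.\<close>

lemma odd_in_grid_iff:
  assumes "odd p" shows "of_int p * 2 powi k \<in> grid w \<longleftrightarrow> w \<le> k"
proof
  assume "of_int p * 2 powi k \<in> grid w"
  then obtain m where m: "of_int p * 2 powi k = (of_int m * 2 powi w :: real)" by (rule gridE)
  show "w \<le> k"
  proof (rule ccontr)
    assume "\<not> w \<le> k"
    then have "(2::real) powi (w - k) = of_int (2 ^ nat (w - k))" by (intro powi2_nonneg_int) simp
    moreover have "(2::real) powi w = 2 powi (w - k) * 2 powi k" by (simp flip: powi2_add)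
    ultimately have "(2::real) powi w = of_int (2 ^ nat (w - k)) * 2 powi k" by (simp only:)
    then have "of_int p * (2::real) powi k = of_int (m * 2 ^ nat (w - k)) * 2 powi k"
      using m by (simp only: of_int_mult mult.assoc)
    then have "(of_int p :: real) = of_int (m * 2 ^ nat (w - k))"
      by (subst (asm) mult_right_cancel) simp_all
    then have "p = m * 2 ^ nat (w - k)" by (simp only: of_int_eq_iff)
    moreover have "nat (w - k) > 0" using \<open>\<not> w \<le> k\<close> by simp
    ultimately show False using assms by simp
  qed
next
  assume "w \<le> k" then show "of_int p * 2 powi k \<in> grid w"
    by (rule grid_mono[rotated]) (rule gridI[of _ p], simp)
qed

lemma Dy_dense:
  fixes a b :: real
  assumes "a < b" obtains d where "d \<in> Dy" "a < d" "d < b"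
proof -
  obtain n where n: "(1/2::real) ^ n < b - a" using real_arch_pow_inv[of "b - a" "1/2"] assms by auto
  define k where "k = \<lfloor>a * 2 ^ n\<rfloor> + 1"
  have 1: "a * 2 ^ n < of_int k" "of_int k \<le> a * 2 ^ n + 1" unfolding k_def by linarith+
  have p: "(2::real) powi (- int n) = 1 / 2 ^ n" by (simp add: power_int_minus_divide)
  have n': "1 < (b - a) * 2 ^ n" using n by (simp add: power_one_over pos_divide_less_eq)
  have "a < of_int k * 2 powi (- int n)" using 1 by (simp add: p pos_less_divide_eq)
  moreover have "of_int k * 2 powi (- int n) < b" using 1 n' by (simp add: p pos_divide_less_eq left_diff_distrib)
  moreover have "of_int k * 2 powi (- int n) \<in> Dy" by (auto simp: Dy_def)
  ultimately show ?thesis using that by blast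
qed

subsection \<open>Doubling-invariant cocycles\<close>

text \<open>Abstract slope jumps: \<open>b q x\<close> stands for the base 2 logarithm of the right
  slope over the left slope of the conjugated translation by \<open>q\<close>, at the point labelled
  \<open>x\<close>. Then \<open>b_add\<close> is the chain rule and \<open>b_double\<close>
  expresses commutation with doubling.\<close>

locale dyadic_cocycle =
  fixes b :: "real \<Rightarrow> real \<Rightarrow> int"
  assumes b_add: "\<And>q r x. \<lbrakk>q \<in> Dy; r \<in> Dy; x \<in> Dy; 0 \<le> q; 0 \<le> r; 0 < x\<rbrakk> \<Longrightarrow> b (q + r) x = b q x + b r (x + q)"
    and b_double: "\<And>q x. \<lbrakk>q \<in> Dy; x \<in> Dy; 0 \<le> q; 0 < x\<rbrakk> \<Longrightarrow> b (2 * q) (2 * x) = b q x"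
    and finite_support: "finite {x \<in> Dy. 0 < x \<and> x < 1 \<and> b 1 x \<noteq> 0}"
begin

text \<open>A potential for the cocycle on the positive integers. The base point is \<open>1\<close>
  because the cocycle is controlled only at positive points.\<close>

definition J :: "nat \<Rightarrow> int" where "J n = b (real n - 1) 1"

lemma b_nat:
  assumes "m \<ge> 1" shows "b (real l) (real m) = J (m + l) - J m"
  using b_add[of "real m - 1" "real l" 1] assms by (simp add: J_def Dy_diff algebra_simps)

lemma b_scale:
  assumes "q \<in> Dy" "x \<in> Dy" "0 \<le> q" "0 < x"
  shows "b (2 powi k * q) (2 powi k * x) = b q x"
proof -
  have up: "b (2 ^ n * q) (2 ^ n * x) = b q x"
    if "q \<in> Dy" "x \<in> Dy" "0 \<le> q" "0 < x" for n :: nat and q x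
  proof (induction n)
    case (Suc n)
    have "2 ^ n * q \<in> Dy" "2 ^ n * x \<in> Dy"
      using that Dy_scale[of q "int n"] Dy_scale[of x "int n"] by simp_all
    then show ?case using b_double[of "2 ^ n * q" "2 ^ n * x"] that Suc by (simp add: mult.assoc)
  qed simp
  show ?thesis
  proof (cases "k \<ge> 0")
    case True
    then show ?thesis using up[OF assms, of "nat k"] by (simp add: power_int_def)
  next
    case False
    define n where "n = nat (- k)"
    have k: "k = - int n" using False by (simp add: n_def)
    have "b (2 ^ n * (2 powi k * q)) (2 ^ n * (2 powi k * x)) = b (2 powi k * q) (2 powi k * x)"
      by (rule up) (use assms in auto)
    moreover have "(2::real) ^ n * (2 powi k * z) = z" for z by (simp add: k power_int_minus)
    ultimately show ?thesis by simp
  qed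
qed

lemma J_double: assumes "n \<ge> 1" shows "J (2 * n) = J n + J 2"
proof -
  have "b (real (2 * n - 2)) (real 2) = J (2 + (2 * n - 2)) - J 2" by (rule b_nat) simp
  moreover have "b (2 * (real n - 1)) (2 * 1) = J n"
    unfolding J_def by (rule b_double) (use assms in \<open>auto intro: Dy_diff\<close>)
  moreover have "real (2 * n - 2) = 2 * (real n - 1)" "2 + (2 * n - 2) = 2 * n"
    using assms by (auto simp: of_nat_diff)
  ultimately show ?thesis by simp
qed

lemma J_power: assumes "n \<ge> 1" shows "J (2 ^ M * n) = J n + int M * J 2"
proof (induction M)
  case (Suc M)
  have "2 ^ M * n \<ge> 1" using assms by (simp add: Suc_leI)
  from J_double[OF this] Suc show ?case by (simp add: mult.assoc algebra_simps)
qed simp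

text \<open>Multiplication by \<open>2 ^ r\<close> moves a dyadic point and the unit translation to
  integers, so \<open>J\<close> determines every jump of the unit translation.\<close>

lemma b_dyadic: "b 1 (real p * 2 powi (- int r)) = J (p + 2 ^ r) - J p" if "p \<ge> 1"
proof -
  have "b (2 powi (- int r) * real (2 ^ r)) (2 powi (- int r) * real p) = b (real (2 ^ r)) (real p)"
    by (rule b_scale) (use that Dy_of_nat[of "2 ^ r"] in auto)
  also have "2 powi (- int r) * real (2 ^ r) = 1" by (simp add: power_int_minus)
  finally show ?thesis using b_nat[OF that, of "2 ^ r"] by (simp add: mult.commute)
qed

text \<open>The finitely many points of the support have bounded denominators, so
  \<open>p / 2 ^ r\<close> with \<open>p\<close> odd and \<open>r\<close> large is not among them.
  Adding \<open>2 ^ r\<close> to \<open>p\<close> prepends a binary digit.\<close>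

lemma J_remove_top_bit:
  obtains R where "R \<ge> 1" "\<And>r p. \<lbrakk>r \<ge> R; odd p; p < 2 ^ r\<rbrakk> \<Longrightarrow> J (p + 2 ^ r) = J p"
proof -
  let ?F = "{x \<in> Dy. 0 < x \<and> x < 1 \<and> b 1 x \<noteq> 0}"
  have "\<forall>x\<in>?F. \<exists>w. x \<in> grid w" by (auto elim: DyE_grid)
  then obtain lev where lev: "\<And>x. x \<in> ?F \<Longrightarrow> x \<in> grid (lev x)" by metis
  \<comment> \<open>If the support is empty, \<open>Min\<close> is unspecified, but then the bound
    is vacuous.\<close>
  obtain W where W: "\<And>x. x \<in> ?F \<Longrightarrow> W \<le> lev x"
  proof
    fix x assume "x \<in> ?F"
    then show "Min (lev ` ?F) \<le> lev x" using finite_support by (intro Min_le) auto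
  qed
  show ?thesis
  proof
    show "1 \<le> max 1 (nat (1 - W))" by simp
    fix r p :: nat assume r: "max 1 (nat (1 - W)) \<le> r" and p: "odd p" "p < 2 ^ r"
    define x where "x = real p * 2 powi (- int r)"
    have "p \<ge> 1" using p(1) by (cases p) auto
    have x_eq: "x = of_int (int p) * 2 powi (- int r)" by (simp add: x_def)
    have "x \<notin> grid W"
      unfolding x_eq by (subst odd_in_grid_iff) (use p r in auto)
    then have "x \<notin> ?F" using lev W grid_mono by blast
    moreover have "x \<in> Dy" unfolding x_eq Dy_def by blast
    moreover have "x > 0" using \<open>p \<ge> 1\<close> by (simp add: x_def)
    moreover have "x < 1"
    proof -
      have "real p < 2 ^ r" using p(2) by (metis of_nat_less_iff of_nat_numeral of_nat_power)
      then show ?thesis by (simp add: x_def power_int_minus field_simps)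
    qed
    ultimately have "b 1 x = 0" by blast
    then show "J (p + 2 ^ r) = J p" using b_dyadic[OF \<open>p \<ge> 1\<close>, of r] by (simp add: x_def)
  qed
qed

text \<open>Restricted to odd arguments, since on even ones \<open>J\<close> may grow by
  \<open>J 2\<close> with each doubling. The condition \<open>L \<ge> 1\<close> keeps
  \<open>p + 2 ^ L\<close> odd.\<close>

definition periodic :: "nat \<Rightarrow> bool" where
  "periodic L \<longleftrightarrow> L \<ge> 1 \<and> (\<forall>p. odd p \<longrightarrow> J (p + 2 ^ L) = J p)"

text \<open>Leading binary digits at positions \<open>R\<close> and above can be removed one at a
  time without changing \<open>J\<close>, so only the residue modulo \<open>2 ^ R\<close> matters.
  Oddness survives because \<open>R \<ge> 1\<close>.\<close>

lemma periodic_exists: "\<exists>L. periodic L"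
proof -
  obtain R where R: "R \<ge> 1" and top: "\<And>r p. \<lbrakk>r \<ge> R; odd p; p < 2 ^ r\<rbrakk> \<Longrightarrow> J (p + 2 ^ r) = J p"
    using J_remove_top_bit by metis
  have J_mod: "J p = J (p mod 2 ^ R)" if "odd p" for p
    using that
  proof (induction p rule: less_induct)
    case (less p)
    show ?case
    proof (cases "p < 2 ^ R")
      case False
      have "p \<ge> 1" using less.prems by (cases p) auto
      then obtain r where r: "2 ^ r \<le> p" "p < 2 ^ (r + 1)"
        using ex_power_ivl1[of 2 p] by auto
      have "r \<ge> R"
      proof (rule ccontr)
        assume "\<not> r \<ge> R"
        then have "(2::nat) ^ (r + 1) \<le> 2 ^ R" by (intro power_increasing) auto
        then show False using r False by linarith
      qed
      have "even ((2::nat) ^ r)" using R \<open>r \<ge> R\<close> by simp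
      then have odd: "odd (p - 2 ^ r)" using r(1) less.prems by simp
      have "p - 2 ^ r < p" using r(1) \<open>p \<ge> 1\<close> by (simp add: Suc_le_lessD)
      have "J p = J (p - 2 ^ r)"
        using top[OF \<open>r \<ge> R\<close> odd] r by simp
      also have "\<dots> = J ((p - 2 ^ r) mod 2 ^ R)" by (rule less.IH) fact+
      also have "(p - 2 ^ r) mod 2 ^ R = p mod 2 ^ R"
        using \<open>r \<ge> R\<close> r(1) by (metis dvd_minus_mod le_imp_power_dvd mod_eq_dvd_iff_nat dvd_imp_mod_0 diff_diff_cancel diff_le_self)
      finally show ?thesis .
    qed simp
  qed
  have "periodic R"
    unfolding periodic_def
  proof (intro conjI allI impI R)
    fix p :: nat assume "odd p"
    moreover from this have "odd (p + 2 ^ R)" using R by simp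
    ultimately show "J (p + 2 ^ R) = J p" using J_mod[of p] J_mod[of "p + 2 ^ R"] by simp
  qed
  then show ?thesis ..
qed

lemma periodic_cong:
  assumes "periodic L" "odd p" "p mod 2 ^ L = q mod 2 ^ L"
  shows "J p = J q"
proof -
  have "L \<ge> 1" using assms(1) by (simp add: periodic_def)
  have step: "J (p + k * 2 ^ L) = J p" if "odd p" for p k
  proof (induction k)
    case (Suc k)
    have "odd (p + k * 2 ^ L)" using that \<open>L \<ge> 1\<close> by simp
    then have "J (p + k * 2 ^ L + 2 ^ L) = J (p + k * 2 ^ L)"
      using assms(1) by (simp add: periodic_def)
    with Suc show ?case by (simp add: algebra_simps)
  qed simp
  have mod_odd: "odd (p mod 2 ^ L)"
    using assms(2) \<open>L \<ge> 1\<close> dvd_mod_iff[of 2 "2 ^ L" p] by simp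
  have "J p = J (p mod 2 ^ L)"
    using step[OF mod_odd, of "p div 2 ^ L"] by (metis mod_div_mult_eq)
  moreover have "J q = J (q mod 2 ^ L)"
    using step[of "q mod 2 ^ L" "q div 2 ^ L"] mod_odd assms(3) by (metis mod_div_mult_eq)
  ultimately show ?thesis using assms(3) by simp
qed

text \<open>A dyadic point of \<open>(0, 1)\<close> is \<open>n / 2 ^ r\<close> with
  \<open>n\<close> odd and \<open>r \<ge> 1\<close>, so both arguments of \<open>J\<close> in
  \<open>b_dyadic\<close> are odd.\<close>

lemma trivial_if_constant:
  assumes const: "\<And>p. odd p \<Longrightarrow> J p = J 1" and x: "x \<in> Dy" "0 < x" "x < 1"
  shows "b 1 x = 0"
proof -
  obtain p k :: int where p: "odd p" "x = of_int p * 2 powi k" using Dy_odd[of x] x by auto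
  have "p > 0" using x(2) p(2) by (simp add: zero_less_mult_iff)
  have "k < 0"
  proof (rule ccontr)
    assume "\<not> k < 0"
    then have "(2::real) powi 0 \<le> 2 powi k" by (intro power_int_increasing) auto
    moreover have "real_of_int p \<ge> 1" using \<open>p > 0\<close> by simp
    ultimately have "1 * 1 \<le> real_of_int p * 2 powi k" by (intro mult_mono) auto
    then show False using x p by simp
  qed
  define r where "r = nat (- k)"
  define n where "n = nat p"
  have n: "odd n" "n \<ge> 1" "x = real n * 2 powi (- int r)"
    using p \<open>p > 0\<close> \<open>k < 0\<close> by (auto simp: n_def r_def even_nat_iff)
  have "odd (n + 2 ^ r)" using n(1) \<open>k < 0\<close> by (simp add: r_def)
  then show ?thesis using b_dyadic[OF n(2), of r] const[OF n(1)] const[of "n + 2 ^ r"] n(3) by simp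
qed

definition nontrivial :: bool where
  "nontrivial \<longleftrightarrow> (\<exists>x\<in>Dy. 0 < x \<and> x < 1 \<and> b 1 x \<noteq> 0)"

text \<open>Here \<open>2 ^ Suc R\<close> is the least period, like the conductor of a character. A
  least period of \<open>2\<close> would make \<open>J\<close> constant on the odd numbers and the
  cocycle trivial, hence \<open>R \<ge> 1\<close>.\<close>

lemma conductor:
  assumes nontrivial
  obtains R u where "R \<ge> 1" "periodic (Suc R)" "odd u" "J (u + 2 ^ R) \<noteq> J u"
proof -
  define L where "L = (LEAST L. periodic L)"
  have L: "periodic L" unfolding L_def using periodic_exists by (rule LeastI_ex)
  have "L \<ge> 2"
  proof (rule ccontr)
    assume "\<not> L \<ge> 2"
    then have "L = 1" using L by (simp add: periodic_def)
    then have "J p = J 1" if "odd p" for p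
      using periodic_cong[of 1 p 1] L that by (simp add: odd_iff_mod_2_eq_one)
    then show False using assms trivial_if_constant unfolding nontrivial_def by blast
  qed
  define R where "R = L - 1"
  have "\<not> periodic R" using not_less_Least[of R periodic] \<open>L \<ge> 2\<close> by (simp add: R_def L_def)
  moreover have "L = Suc R" using \<open>L \<ge> 2\<close> by (simp add: R_def)
  ultimately show ?thesis using that[of R] L \<open>L \<ge> 2\<close> by (auto simp: periodic_def)
qed

text \<open>With \<open>t = u mod 2 ^ R\<close>, the numbers \<open>2 ^ R * d + t\<close> form two
  classes modulo \<open>2 ^ Suc R\<close>, told apart by the parity of \<open>d\<close>, and
  \<open>J\<close> separates these classes. Translation by \<open>q\<close> changes \<open>d\<close>
  by an odd number, so it swaps the classes and \<open>J\<close> changes. The break found lies at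
  offset \<open>t * 2 powi (w - R)\<close> inside the gap.\<close>

lemma jump_in_every_gap:
  assumes nontrivial
    and o: "odd k" "k > 0" and q: "q = of_int k * 2 powi w"
    and y: "y \<in> grid w" "y \<ge> 0"
  obtains z where "z \<in> Dy" "y < z" "z < y + 2 powi w" "b q z \<noteq> 0"
proof -
  obtain R u where R: "R \<ge> 1" "periodic (Suc R)" "odd u" "J (u + 2 ^ R) \<noteq> J u"
    by (rule conductor[OF assms(1)])
  obtain m :: int where m: "y = of_int m * 2 powi w" using y(1) by (rule gridE)
  have "m \<ge> 0" using y(2) m by (simp add: zero_le_mult_iff not_le)
  define c where "c = nat m"
  define l where "l = nat k"
  have l: "odd l" and c: "y = real c * 2 powi w" and q': "q = real l * 2 powi w"
    using o \<open>m \<ge> 0\<close> m q by (auto simp: c_def l_def even_nat_iff)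
  define t where "t = u mod 2 ^ R"
  have t: "t < 2 ^ R" "odd t" "t > 0"
    using R(1,3) by (auto simp: t_def dvd_mod_iff intro!: odd_pos)
  define n where "n = 2 ^ R * c + t"
  have mod_n: "(2 ^ R * d + t) mod 2 ^ Suc R = 2 ^ R * (d mod 2) + t" for d
    using t(1) mod_mult2_eq[of "2 ^ R * d + t" "2 ^ R" 2] by (simp add: mult.commute)
  define e where "e = u div 2 ^ R"
  have u: "u = 2 ^ R * e + t" by (simp add: e_def t_def)
  have odd_n: "odd n" using t R(1) by (simp add: n_def)
  have n': "n + 2 ^ R * l = 2 ^ R * (c + l) + t" and u': "u + 2 ^ R = 2 ^ R * (e + 1) + t"
    by (simp_all add: n_def u algebra_simps)
  have odd_n': "odd (n + 2 ^ R * l)" using odd_n R(1) by simp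
  have same: "J p = J q"
    if "odd p" "p = 2 ^ R * d + t" "q = 2 ^ R * d' + t" "even d \<longleftrightarrow> even d'" for p q d d'
  proof (rule periodic_cong[OF R(2) that(1)])
    have d: "d mod 2 = d' mod 2" using that(4) by (simp add: mod2_eq_if)
    have "p mod 2 ^ Suc R = 2 ^ R * (d mod 2) + t" unfolding that(2) by (rule mod_n)
    also have "\<dots> = q mod 2 ^ Suc R" unfolding that(3) d by (rule mod_n[symmetric])
    finally show "p mod 2 ^ Suc R = q mod 2 ^ Suc R" .
  qed
  have "J (n + 2 ^ R * l) \<noteq> J n"
  proof (cases "even c \<longleftrightarrow> even e")
    case True
    have "J (n + 2 ^ R * l) = J (u + 2 ^ R)"
      by (rule same[OF odd_n' n' u']) (use True l in simp)
    moreover have "J n = J u" by (rule same[OF odd_n n_def u True])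
    ultimately show ?thesis using R(4) by simp
  next
    case False
    have "J n = J (u + 2 ^ R)"
      by (rule same[OF odd_n n_def u']) (use False in simp)
    moreover have "J (n + 2 ^ R * l) = J u"
      by (rule same[OF odd_n' n' u]) (use False l in simp)
    ultimately show ?thesis using R(4) by simp
  qed
  moreover define z where "z = 2 powi (w - int R) * real n"
  have pw: "(2::real) powi w = 2 powi (w - int R) * 2 ^ R"
    using powi2_add[of "w - int R" "int R"] by simp
  have "b (2 powi (w - int R) * real (2 ^ R * l)) (2 powi (w - int R) * real n) = b (real (2 ^ R * l)) (real n)"
    by (rule b_scale) (use odd_pos[OF odd_n] in \<open>auto simp del: of_nat_mult\<close>)
  moreover have "2 powi (w - int R) * real (2 ^ R * l) = q" by (simp add: q' pw)
  moreover have "b (real (2 ^ R * l)) (real n) = J (n + 2 ^ R * l) - J n"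
    by (rule b_nat) (use odd_pos[OF odd_n] in simp)
  ultimately have "b q z \<noteq> 0" by (simp add: z_def)
  moreover have "z \<in> Dy" by (simp add: z_def)
  moreover have z: "z = y + 2 powi (w - int R) * real t" by (simp add: z_def n_def c pw algebra_simps)
  then have "y < z" using t by simp
  moreover have "z < y + 2 powi w"
  proof -
    have "real t < 2 ^ R" using t(1) by (metis of_nat_less_iff of_nat_numeral of_nat_power)
    then show ?thesis by (simp add: z pw)
  qed
  ultimately show ?thesis using that by blast
qed

text \<open>For \<open>M > R\<close> the number \<open>2 ^ M * u + 1\<close> is congruent to
  \<open>1\<close> modulo the period, so its \<open>J\<close> vanishes, while
  \<open>J (2 ^ M * u) = J u + M * J 2\<close>. If \<open>J 2 = 0\<close>, any odd \<open>u\<close>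
  with \<open>J u \<noteq> 0\<close> works for all such \<open>M\<close>; otherwise
  \<open>u = 1\<close> does.\<close>

lemma jump_at_highly_divisible:
  assumes nontrivial
  obtains u where "odd u" "\<And>N. \<exists>M\<ge>N. b 1 (2 ^ M * real u) \<noteq> 0"
proof -
  obtain R v where R: "R \<ge> 1" "periodic (Suc R)" "odd v" "J (v + 2 ^ R) \<noteq> J v"
    by (rule conductor[OF assms(1)])
  have J1: "J 1 = 0"
    using b_nat[of 1 0] b_add[of 0 0 1] by (simp add: J_def)
  have b_eq: "b 1 (2 ^ M * real u) = - J u - int M * J 2" if "odd u" "M \<ge> Suc R" for u M
  proof -
    have "u \<ge> 1" using that(1) by (cases u) auto
    have "b (real 1) (real (2 ^ M * u)) = J (2 ^ M * u + 1) - J (2 ^ M * u)"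
      by (rule b_nat) (use \<open>u \<ge> 1\<close> in \<open>simp add: Suc_leI\<close>)
    moreover have "J (2 ^ M * u + 1) = J 1"
    proof (rule periodic_cong[OF R(2)])
      show "odd (2 ^ M * u + 1)" using that(2) by simp
      have "2 ^ Suc R dvd (2::nat) ^ M" using that(2) by (rule le_imp_power_dvd)
      then have "2 ^ Suc R dvd 2 ^ M * u" by (rule dvd_mult2)
      then have "(2 ^ M * u) mod 2 ^ Suc R = 0" by (rule dvd_imp_mod_0)
      then show "(2 ^ M * u + 1) mod 2 ^ Suc R = 1 mod 2 ^ Suc R"
        using mod_add_left_eq[of "2 ^ M * u" "2 ^ Suc R" 1] by (simp only: add_0)
    qed
    ultimately show ?thesis using J_power[OF \<open>u \<ge> 1\<close>, of M] J1 by simp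
  qed
  show ?thesis
  proof (cases "J 2 = 0")
    case True
    have "odd (v + 2 ^ R)" using R by simp
    then have "\<exists>u. odd u \<and> J u \<noteq> 0" using R(3,4) by metis
    then obtain u where u: "odd u" "J u \<noteq> 0" by blast
    show ?thesis
    proof (rule that[OF u(1)])
      fix N
      define M where "M = max N (Suc R)"
      have "M \<ge> N" "M \<ge> Suc R" by (simp_all add: M_def)
      then show "\<exists>M\<ge>N. b 1 (2 ^ M * real u) \<noteq> 0" using b_eq[OF u(1), of M] u(2) True by auto
    qed
  next
    case False
    show ?thesis
    proof (rule that[of 1])
      fix N
      define M where "M = max N (Suc R)"
      have "M \<ge> N" "M \<ge> Suc R" by (simp_all add: M_def)
      then show "\<exists>M\<ge>N. b 1 (2 ^ M * real 1) \<noteq> 0" using b_eq[of 1 M] J1 False by auto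
    qed simp
  qed
qed

end

subsection \<open>Maps of the half line commuting with doubling\<close>

text \<open>The pair of slope and intercept is determined by the germ, hence locally constant, hence
  constant on the connected interval.\<close>

lemma locally_affine_imp_affine:
  fixes f :: "real \<Rightarrow> real"
  assumes loc: "\<And>x. a < x \<Longrightarrow> x < b \<Longrightarrow> \<exists>c d. \<forall>\<^sub>F s in nhds x. f s = c * s + d"
  obtains c d where "\<And>x. a < x \<Longrightarrow> x < b \<Longrightarrow> f x = c * x + d"
proof (cases "a < b")
  case True
  define P where "P x p \<longleftrightarrow> (\<forall>\<^sub>F s in nhds x. f s = fst p * s + snd p)" for x and p :: "real \<times> real"
  have ex: "\<exists>p. P x p" if "a < x" "x < b" for x
    using loc[OF that] by (auto simp: P_def)
  have uniq: "p = q" if "P x p" "P x q" for x p q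
  proof -
    have "\<forall>\<^sub>F s in nhds x. fst p * s + snd p = fst q * s + snd q"
      using that unfolding P_def by eventually_elim simp
    then obtain e where e: "e > 0" "\<And>s. dist s x < e \<Longrightarrow> fst p * s + snd p = fst q * s + snd q"
      unfolding eventually_nhds_metric by blast
    have 1: "fst p * x + snd p = fst q * x + snd q" using e by simp
    have 2: "fst p * (x + e / 2) + snd p = fst q * (x + e / 2) + snd q"
      using e by (intro e(2)) (simp add: dist_real_def)
    have "fst p * (e / 2) = fst q * (e / 2)" using 1 2 unfolding distrib_left by linarith
    then have "fst p = fst q" using e(1) by simp
    with 1 show ?thesis by (simp add: prod_eq_iff)
  qed
  define g where "g x = (SOME p. P x p)" for x
  have g: "P x (g x)" if "a < x" "x < b" for x
    unfolding g_def using ex[OF that] by (rule someI_ex)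
  have const: "g x = g y" if "x \<in> {a<..<b}" "y \<in> {a<..<b}" for x y
  proof (rule connected_local_const[OF _ that])
    show "\<forall>x\<in>{a<..<b}. \<forall>\<^sub>F y in at x within {a<..<b}. g x = g y"
    proof
      fix x assume x: "x \<in> {a<..<b}"
      then have "\<forall>\<^sub>F y in nhds x. \<forall>\<^sub>F s in nhds y. f s = fst (g x) * s + snd (g x)"
        using g[of x] unfolding P_def by (subst eventually_eventually) simp
      then have "\<forall>\<^sub>F y in nhds x. P y (g x)" by (simp add: P_def)
      moreover have "\<forall>\<^sub>F y in nhds x. y \<in> {a<..<b}" using x by (intro eventually_nhds_in_open) auto
      ultimately have "\<forall>\<^sub>F y in nhds x. g x = g y"
        by eventually_elim (use g uniq in auto)
      then show "\<forall>\<^sub>F y in at x within {a<..<b}. g x = g y"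
        by (rule filter_leD[OF at_within_le_nhds])
    qed
  qed simp
  show ?thesis
  proof (rule that)
    fix x assume x: "a < x" "x < b"
    define m where "m = (a + b) / 2"
    have m: "a < m" "m < b" using True by (auto simp: m_def)
    have "P x (g m)" using g[OF x] const[of x m] x m by simp
    then have "f x = fst (g m) * x + snd (g m)"
      unfolding P_def by (rule eventually_nhds_x_imp_x)
    then show "f x = fst (g m) * x + snd (g m)" .
  qed
qed (use that in auto)

text \<open>The last assumption is the PL condition for the conjugated translation at the point \<open>\<phi> x\<close>.\<close>

locale renorm_map =
  fixes \<phi> \<psi> :: "real \<Rightarrow> real"
  assumes mono: "\<And>x y. 0 \<le> x \<Longrightarrow> x < y \<Longrightarrow> \<phi> x < \<phi> y"
    and nonneg: "\<And>x. 0 \<le> x \<Longrightarrow> 0 \<le> \<phi> x" "\<And>y. 0 \<le> y \<Longrightarrow> 0 \<le> \<psi> y"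
    and inv: "\<And>x. 0 \<le> x \<Longrightarrow> \<psi> (\<phi> x) = x" "\<And>y. 0 \<le> y \<Longrightarrow> \<phi> (\<psi> y) = y"
    and double: "\<And>x. 0 \<le> x \<Longrightarrow> \<phi> (2 * x) = 2 * \<phi> x"
    and Dy: "\<And>x. 0 \<le> x \<Longrightarrow> \<phi> x \<in> Dy \<longleftrightarrow> x \<in> Dy"
    and pl: "\<And>q x. \<lbrakk>q \<in> Dy; 0 \<le> q; 0 \<le> x\<rbrakk> \<Longrightarrow> \<exists>e>0. \<exists>i j :: int.
      (\<forall>t\<in>{0..e}. \<phi> (\<psi> (\<phi> x + t) + q) = \<phi> (x + q) + 2 powi i * t) \<and>
      (0 < x \<longrightarrow> e \<le> \<phi> x \<and> (\<forall>t\<in>{0..e}. \<phi> (\<psi> (\<phi> x - t) + q) = \<phi> (x + q) - 2 powi j * t) \<and>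
        (x \<notin> Dy \<longrightarrow> i = j))"
begin

section \<open>Conjugated translations, their one-sided slopes and their jumps\<close>

definition \<tau> :: "real \<Rightarrow> real \<Rightarrow> real" where "\<tau> q z = \<phi> (\<psi> z + q)"

lemma zero: "\<phi> 0 = 0" using double[of 0] by simp

lemma pos: "0 < x \<Longrightarrow> 0 < \<phi> x" using mono[of 0 x] zero by simp

lemma less_iff: "0 \<le> x \<Longrightarrow> 0 \<le> y \<Longrightarrow> \<phi> x < \<phi> y \<longleftrightarrow> x < y"
  using mono[of x y] mono[of y x] by (cases x y rule: linorder_cases) auto

lemma \<psi>_less_iff: "0 \<le> x \<Longrightarrow> 0 \<le> y \<Longrightarrow> \<psi> x < y \<longleftrightarrow> x < \<phi> y" "0 \<le> x \<Longrightarrow> 0 \<le> y \<Longrightarrow> y < \<psi> x \<longleftrightarrow> \<phi> y < x"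
  using less_iff[of "\<psi> x" y] less_iff[of y "\<psi> x"] nonneg inv by auto

lemma \<psi>_double: "0 \<le> y \<Longrightarrow> \<psi> (2 * y) = 2 * \<psi> y"
  using double[of "\<psi> y"] inv(1)[of "2 * \<psi> y"] inv(2)[of y] nonneg(2)[of y] by simp

lemma \<tau>_\<phi>: "0 \<le> x \<Longrightarrow> \<tau> q (\<phi> x) = \<phi> (x + q)"
  by (simp add: \<tau>_def inv)

lemma \<tau>_add: "0 \<le> z \<Longrightarrow> 0 \<le> q \<Longrightarrow> \<tau> (q + r) z = \<tau> r (\<tau> q z)"
  by (simp add: \<tau>_def inv nonneg add.assoc)

lemma \<tau>_double: "0 \<le> z \<Longrightarrow> 0 \<le> q \<Longrightarrow> \<tau> (2 * q) (2 * z) = 2 * \<tau> q z"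
  using double[of "\<psi> z + q"] by (simp add: \<tau>_def \<psi>_double nonneg distrib_left)

definition rslope :: "real \<Rightarrow> real \<Rightarrow> int \<Rightarrow> bool" where
  "rslope q x i \<longleftrightarrow> (\<exists>e>0. \<forall>t\<in>{0..e}. \<tau> q (\<phi> x + t) = \<phi> (x + q) + 2 powi i * t)"

text \<open>The bound \<open>e \<le> \<phi> x\<close> keeps \<open>\<phi> x - t\<close> in the half
  line, where \<open>\<psi>\<close> is controlled.\<close>

definition lslope :: "real \<Rightarrow> real \<Rightarrow> int \<Rightarrow> bool" where
  "lslope q x j \<longleftrightarrow> (\<exists>e>0. e \<le> \<phi> x \<and> (\<forall>t\<in>{0..e}. \<tau> q (\<phi> x - t) = \<phi> (x + q) - 2 powi j * t))"

lemma rslope_unique: assumes "rslope q x i" "rslope q x i'" shows "i = i'"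
proof -
  obtain e e' where e: "e > 0" "\<forall>t\<in>{0..e}. \<tau> q (\<phi> x + t) = \<phi> (x + q) + 2 powi i * t"
    "e' > 0" "\<forall>t\<in>{0..e'}. \<tau> q (\<phi> x + t) = \<phi> (x + q) + 2 powi i' * t"
    using assms unfolding rslope_def by blast
  define t where "t = min e e'"
  have "t > 0" "t \<in> {0..e}" "t \<in> {0..e'}" using e by (auto simp: t_def)
  then have "2 powi i * t = (2 powi i' * t :: real)" using e by (metis add_left_cancel)
  then show ?thesis using \<open>t > 0\<close> by (simp add: powi2_inj)
qed

lemma lslope_unique: assumes "lslope q x i" "lslope q x i'" shows "i = i'"
proof -
  obtain e e' where e: "e > 0" "\<forall>t\<in>{0..e}. \<tau> q (\<phi> x - t) = \<phi> (x + q) - 2 powi i * t"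
    "e' > 0" "\<forall>t\<in>{0..e'}. \<tau> q (\<phi> x - t) = \<phi> (x + q) - 2 powi i' * t"
    using assms unfolding lslope_def by blast
  define t where "t = min e e'"
  have t: "t > 0" "t \<in> {0..e}" "t \<in> {0..e'}" using e by (auto simp: t_def)
  have "\<tau> q (\<phi> x - t) = \<phi> (x + q) - 2 powi i * t" "\<tau> q (\<phi> x - t) = \<phi> (x + q) - 2 powi i' * t"
    using e t by blast+
  then have "2 powi i * t = (2 powi i' * t :: real)" by linarith
  then show ?thesis using \<open>t > 0\<close> by (simp add: powi2_inj)
qed

lemma slopes_exist:
  assumes "q \<in> Dy" "0 \<le> q" "0 < x"
  obtains i j where "rslope q x i" "lslope q x j" "x \<notin> Dy \<Longrightarrow> i = j"
proof -
  obtain e i j where e: "e > 0" "\<forall>t\<in>{0..e}. \<phi> (\<psi> (\<phi> x + t) + q) = \<phi> (x + q) + 2 powi i * t"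
    "e \<le> \<phi> x" "\<forall>t\<in>{0..e}. \<phi> (\<psi> (\<phi> x - t) + q) = \<phi> (x + q) - 2 powi j * t" "x \<notin> Dy \<longrightarrow> i = j"
    using pl[OF assms(1,2), of x] assms(3) by auto
  show ?thesis
  proof (rule that)
    show "rslope q x i" "lslope q x j" unfolding rslope_def lslope_def \<tau>_def using e by blast+
  qed (use e in blast)
qed

lemma rslope_exists:
  assumes "q \<in> Dy" "0 \<le> q" "0 \<le> x" obtains i where "rslope q x i"
proof -
  have "\<exists>i. rslope q x i" using pl[OF assms] unfolding rslope_def \<tau>_def by blast
  then show ?thesis using that by blast
qed

text \<open>The jump of \<open>\<tau> q\<close> at \<open>\<phi> x\<close> is labelled by
  \<open>x\<close>, so that under composition the label moves by the plain translation
  \<open>x + q\<close>, as the cocycle identity requires.\<close>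

definition jump :: "real \<Rightarrow> real \<Rightarrow> int" where
  "jump q x = (THE k. \<exists>i j. rslope q x i \<and> lslope q x j \<and> k = i - j)"

lemma jumpI: "rslope q x i \<Longrightarrow> lslope q x j \<Longrightarrow> jump q x = i - j"
  unfolding jump_def by (rule the_equality) (auto dest: rslope_unique lslope_unique)

lemma rslope_add:
  assumes "rslope q x i" "rslope r (x + q) i'" "0 \<le> q" "0 \<le> x" shows "rslope (q + r) x (i + i')"
proof -
  obtain e e' where e: "e > 0" "\<forall>t\<in>{0..e}. \<tau> q (\<phi> x + t) = \<phi> (x + q) + 2 powi i * t"
    "e' > 0" "\<forall>t\<in>{0..e'}. \<tau> r (\<phi> (x + q) + t) = \<phi> (x + q + r) + 2 powi i' * t"
    using assms unfolding rslope_def by blast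
  show ?thesis unfolding rslope_def
  proof (intro exI[of _ "min e (e' / 2 powi i)"] conjI ballI)
    fix t assume t: "t \<in> {0..min e (e' / 2 powi i)}"
    then have "2 powi i * t \<in> {0..e'}" by (auto simp: pos_le_divide_eq mult.commute)
    then show "\<tau> (q + r) (\<phi> x + t) = \<phi> (x + (q + r)) + 2 powi (i + i') * t"
      using e t nonneg[of x] assms(3,4) by (simp add: \<tau>_add powi2_add add.assoc)
  qed (use e in auto)
qed

lemma lslope_add:
  assumes "lslope q x i" "lslope r (x + q) i'" "0 \<le> q" "0 \<le> x" shows "lslope (q + r) x (i + i')"
proof -
  obtain e e' where e: "e > 0" "e \<le> \<phi> x" "\<forall>t\<in>{0..e}. \<tau> q (\<phi> x - t) = \<phi> (x + q) - 2 powi i * t"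
    "e' > 0" "\<forall>t\<in>{0..e'}. \<tau> r (\<phi> (x + q) - t) = \<phi> (x + q + r) - 2 powi i' * t"
    using assms unfolding lslope_def by blast
  show ?thesis unfolding lslope_def
  proof (intro exI[of _ "min e (e' / 2 powi i)"] conjI ballI)
    fix t assume t: "t \<in> {0..min e (e' / 2 powi i)}"
    then have "2 powi i * t \<in> {0..e'}" by (auto simp: pos_le_divide_eq mult.commute)
    then show "\<tau> (q + r) (\<phi> x - t) = \<phi> (x + (q + r)) - 2 powi (i + i') * t"
      using e t nonneg[of x] assms(3,4) by (simp add: \<tau>_add powi2_add add.assoc)
  qed (use e in auto)
qed

lemma rslope_double: assumes "rslope q x i" "0 \<le> q" "0 \<le> x" shows "rslope (2 * q) (2 * x) i"
proof -
  obtain e where e: "e > 0" "\<forall>t\<in>{0..e}. \<tau> q (\<phi> x + t) = \<phi> (x + q) + 2 powi i * t"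
    using assms unfolding rslope_def by blast
  show ?thesis unfolding rslope_def
  proof (intro exI[of _ e] conjI ballI)
    fix t assume t: "t \<in> {0..e}"
    have "\<tau> (2 * q) (\<phi> (2 * x) + t) = \<tau> (2 * q) (2 * (\<phi> x + t / 2))" using assms double by simp
    also have "\<dots> = 2 * \<tau> q (\<phi> x + t / 2)" by (rule \<tau>_double) (use assms nonneg t in auto)
    also have "\<tau> q (\<phi> x + t / 2) = \<phi> (x + q) + 2 powi i * (t / 2)" using e(1) t by (intro e(2)[rule_format]) auto
    also have "2 * (\<phi> (x + q) + 2 powi i * (t / 2)) = \<phi> (2 * x + 2 * q) + 2 powi i * t"
      using double[of "x + q"] assms by (simp add: distrib_left)
    finally show "\<tau> (2 * q) (\<phi> (2 * x) + t) = \<phi> (2 * x + 2 * q) + 2 powi i * t" .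
  qed (use e in auto)
qed

lemma lslope_double: assumes "lslope q x i" "0 \<le> q" "0 \<le> x" shows "lslope (2 * q) (2 * x) i"
proof -
  obtain e where e: "e > 0" "e \<le> \<phi> x" "\<forall>t\<in>{0..e}. \<tau> q (\<phi> x - t) = \<phi> (x + q) - 2 powi i * t"
    using assms unfolding lslope_def by blast
  show ?thesis unfolding lslope_def
  proof (intro exI[of _ e] conjI ballI)
    fix t assume t: "t \<in> {0..e}"
    have "\<tau> (2 * q) (\<phi> (2 * x) - t) = \<tau> (2 * q) (2 * (\<phi> x - t / 2))" using assms double by simp
    also have "\<dots> = 2 * \<tau> q (\<phi> x - t / 2)" by (rule \<tau>_double) (use assms e t in auto)
    also have "\<tau> q (\<phi> x - t / 2) = \<phi> (x + q) - 2 powi i * (t / 2)" using e(1) t by (intro e(3)[rule_format]) auto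
    also have "2 * (\<phi> (x + q) - 2 powi i * (t / 2)) = \<phi> (2 * x + 2 * q) - 2 powi i * t"
      using double[of "x + q"] assms by (simp add: distrib_left right_diff_distrib)
    finally show "\<tau> (2 * q) (\<phi> (2 * x) - t) = \<phi> (2 * x + 2 * q) - 2 powi i * t" .
  qed (use e double assms in auto)
qed

lemma jump_affine:
  assumes aff: "\<And>z. u < z \<Longrightarrow> z < v \<Longrightarrow> \<tau> q z = 2 powi i * z + d"
    and x: "0 < x" "u < \<phi> x" "\<phi> x < v"
  shows "jump q x = 0"
proof -
  define e where "e = min (\<phi> x) (min (\<phi> x - u) (v - \<phi> x)) / 2"
  have e: "e > 0" "e \<le> \<phi> x" "e < \<phi> x - u" "e < v - \<phi> x" using x pos[of x] by (auto simp: e_def min_def field_simps)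
  have base: "\<phi> (x + q) = 2 powi i * \<phi> x + d" using aff[OF x(2,3)] x(1) \<tau>_\<phi>[of x q] by simp
  have "rslope q x i" unfolding rslope_def
    using e base aff by (intro exI[of _ e]) (auto simp: algebra_simps)
  moreover have "lslope q x i" unfolding lslope_def
    using e base aff by (intro exI[of _ e]) (auto simp: algebra_simps)
  ultimately show ?thesis using jumpI by fastforce
qed

text \<open>At points outside \<open>Dy\<close> the one-sided slopes agree anyway, so the absence of
  dyadic jumps makes \<open>\<tau> q\<close> locally affine between \<open>\<phi> a\<close> and
  \<open>\<phi> c\<close>. The one-sided expansions at \<open>a\<close> and \<open>c\<close> carry
  the formula to the endpoints.\<close>

lemma affine_piece:
  assumes q: "q \<in> Dy" "0 \<le> q" and ac: "0 \<le> a" "a < c"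
    and no_jump: "\<And>x. x \<in> Dy \<Longrightarrow> a < x \<Longrightarrow> x < c \<Longrightarrow> jump q x = 0"
  obtains i d where "rslope q a i" "\<And>z. \<phi> a \<le> z \<Longrightarrow> z \<le> \<phi> c \<Longrightarrow> \<tau> q z = 2 powi i * z + d"
proof -
  have "\<exists>k d. \<forall>\<^sub>F s in nhds z. \<tau> q s = k * s + d" if z: "\<phi> a < z" "z < \<phi> c" for z
  proof -
    have z0: "0 \<le> z" using z nonneg[OF ac(1)] by simp
    define x where "x = \<psi> z"
    have x: "a < x" "x < c" "\<phi> x = z" using z z0 ac inv nonneg \<psi>_less_iff by (auto simp: x_def)
    obtain i j where ij: "rslope q x i" "lslope q x j" "x \<notin> Dy \<Longrightarrow> i = j"
      using slopes_exist[OF q, of x] x ac by auto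
    have "i = j" using ij no_jump[of x] x jumpI[of q x i j] by (cases "x \<in> Dy") auto
    obtain e where e: "e > 0" "\<forall>t\<in>{0..e}. \<tau> q (z + t) = \<phi> (x + q) + 2 powi i * t"
      using ij(1) unfolding rslope_def x(3) by blast
    obtain e' where e': "e' > 0" "\<forall>t\<in>{0..e'}. \<tau> q (z - t) = \<phi> (x + q) - 2 powi i * t"
      using ij(2) \<open>i = j\<close> unfolding lslope_def x(3) by blast
    have "\<forall>\<^sub>F s in nhds z. \<tau> q s = 2 powi i * s + (\<phi> (x + q) - 2 powi i * z)"
      unfolding eventually_nhds_metric
    proof (intro exI[of _ "min e e'"] conjI allI impI)
      fix s assume s: "dist s z < min e e'"
      show "\<tau> q s = 2 powi i * s + (\<phi> (x + q) - 2 powi i * z)"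
      proof (cases "s \<ge> z")
        case True
        then have "\<tau> q (z + (s - z)) = \<phi> (x + q) + 2 powi i * (s - z)"
          using s by (intro e(2)[rule_format]) (auto simp: dist_real_def)
        then show ?thesis by (simp add: algebra_simps)
      next
        case False
        then have "\<tau> q (z - (z - s)) = \<phi> (x + q) - 2 powi i * (z - s)"
          using s by (intro e'(2)[rule_format]) (auto simp: dist_real_def)
        then show ?thesis by (simp add: algebra_simps)
      qed
    qed (use e e' in auto)
    then show ?thesis by blast
  qed
  then obtain k d where kd: "\<And>z. \<phi> a < z \<Longrightarrow> z < \<phi> c \<Longrightarrow> \<tau> q z = k * z + d"
    using locally_affine_imp_affine[of "\<phi> a" "\<phi> c" "\<tau> q"] by metis
  have ac': "\<phi> a < \<phi> c" using mono ac by simp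
  obtain i where i: "rslope q a i" using rslope_exists[OF q ac(1)] by blast
  then obtain e where e: "e > 0" "\<forall>t\<in>{0..e}. \<tau> q (\<phi> a + t) = \<phi> (a + q) + 2 powi i * t"
    unfolding rslope_def by blast
  \<comment> \<open>Comparing the two affine expressions at the distances \<open>t\<close> and
    \<open>t / 2\<close> from the endpoint identifies both the slope and the value there; the same
    device is used at \<open>c\<close>.\<close>
  define t where "t = min e ((\<phi> c - \<phi> a) / 2)"
  have t: "t > 0" "t \<le> e" "\<phi> a + t < \<phi> c" using e ac' by (auto simp: t_def min_def field_simps)
  have "k * (\<phi> a + t) + d = \<phi> (a + q) + 2 powi i * t" using e t kd[of "\<phi> a + t"] by auto
  moreover have "k * (\<phi> a + t / 2) + d = \<phi> (a + q) + 2 powi i * (t / 2)"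
    using e(2)[rule_format, of "t / 2"] t kd[of "\<phi> a + t / 2"] by auto
  ultimately have k: "k = 2 powi i" and left: "\<phi> (a + q) = k * \<phi> a + d"
  proof -
    assume A: "k * (\<phi> a + t) + d = \<phi> (a + q) + 2 powi i * t"
      "k * (\<phi> a + t / 2) + d = \<phi> (a + q) + 2 powi i * (t / 2)"
    then have "k * (t / 2) = 2 powi i * (t / 2)" unfolding distrib_left by linarith
    then show "k = 2 powi i" using t by simp
    with A(1) show "\<phi> (a + q) = k * \<phi> a + d" by (simp add: algebra_simps)
  qed
  obtain j where "lslope q c j" using slopes_exist[OF q, of c] ac by auto
  then obtain e where e: "e > 0" "\<forall>t\<in>{0..e}. \<tau> q (\<phi> c - t) = \<phi> (c + q) - 2 powi j * t"
    unfolding lslope_def by blast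
  define t where "t = min e ((\<phi> c - \<phi> a) / 2)"
  have t: "t > 0" "t \<le> e" "\<phi> a < \<phi> c - t" using e ac' by (auto simp: t_def min_def field_simps)
  have A: "k * (\<phi> c - t) + d = \<phi> (c + q) - 2 powi j * t" using e t kd[of "\<phi> c - t"] by auto
  have "k * (\<phi> c - t / 2) + d = \<phi> (c + q) - 2 powi j * (t / 2)"
    using e(2)[rule_format, of "t / 2"] t kd[of "\<phi> c - t / 2"] by auto
  with A have right: "\<phi> (c + q) = k * \<phi> c + d" by (simp add: algebra_simps)
  show ?thesis
  proof (rule that[OF i, of d])
    fix z assume "\<phi> a \<le> z" "z \<le> \<phi> c"
    then consider "z = \<phi> a" | "z = \<phi> c" | "\<phi> a < z" "z < \<phi> c" by linarith
    then show "\<tau> q z = 2 powi i * z + d"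
    proof cases
      case 1 then show ?thesis using left k \<tau>_\<phi>[of a q] ac by simp
    next
      case 2 then show ?thesis using right k \<tau>_\<phi>[of c q] ac by simp
    qed (use kd k in simp)
  qed
qed

text \<open>Every point of the compact interval from \<open>0\<close> to \<open>\<phi> c\<close> has
  punctured one-sided neighbourhoods on which \<open>\<tau> q\<close> is affine, so the breaks have
  no limit point there. At \<open>0\<close> only the right side occurs.\<close>

lemma finite_jumps:
  assumes q: "q \<in> Dy" "0 \<le> q"
  shows "finite {x \<in> Dy. 0 < x \<and> x < c \<and> jump q x \<noteq> 0}" (is "finite ?B")
proof (cases "0 < c")
  case True
  have "finite ({0..\<phi> c} \<inter> \<phi> ` ?B)"
  proof (rule finite_not_islimpt_in_compact)
    fix z assume z: "z \<in> {0..\<phi> c}"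
    show "\<not> z islimpt \<phi> ` ?B"
    proof
      assume lim: "z islimpt \<phi> ` ?B"
      define x where "x = \<psi> z"
      have x: "0 \<le> x" "\<phi> x = z" using z inv nonneg by (auto simp: x_def)
      obtain e i j where e: "e > 0" "\<forall>t\<in>{0..e}. \<phi> (\<psi> (\<phi> x + t) + q) = \<phi> (x + q) + 2 powi i * t"
        "0 < x \<longrightarrow> e \<le> \<phi> x \<and> (\<forall>t\<in>{0..e}. \<phi> (\<psi> (\<phi> x - t) + q) = \<phi> (x + q) - 2 powi j * t) \<and> (x \<notin> Dy \<longrightarrow> i = j)"
        using pl[OF q x(1)] by metis
      obtain x' where x': "x' \<in> ?B" "\<phi> x' \<noteq> z" "dist (\<phi> x') z < e"
        using lim e(1) unfolding islimpt_approachable by blast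
      have "jump q x' = 0"
      proof (cases "\<phi> x' > z")
        case True
        show ?thesis
        proof (rule jump_affine[of z "z + e" q i "\<phi> (x + q) - 2 powi i * z"])
          fix s assume "z < s" "s < z + e"
          then have "\<tau> q (z + (s - z)) = \<phi> (x + q) + 2 powi i * (s - z)"
            using e(2)[rule_format, of "s - z"] x(2) by (auto simp: \<tau>_def)
          then show "\<tau> q s = 2 powi i * s + (\<phi> (x + q) - 2 powi i * z)" by (simp add: algebra_simps)
        qed (use x' True in \<open>auto simp: dist_real_def\<close>)
      next
        case False
        then have "\<phi> x' < z" using x' by simp
        moreover have "0 < \<phi> x'" using x' pos by auto
        ultimately have "0 < x" using x zero by (cases "x = 0") auto
        show ?thesis
        proof (rule jump_affine[of "z - e" z q j "\<phi> (x + q) - 2 powi j * z"])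
          fix s assume "z - e < s" "s < z"
          then have "\<tau> q (z - (z - s)) = \<phi> (x + q) - 2 powi j * (z - s)"
            using e(3)[THEN mp, OF \<open>0 < x\<close>, THEN conjunct2, THEN conjunct1, rule_format, of "z - s"] x(2)
            by (auto simp: \<tau>_def)
          then show "\<tau> q s = 2 powi j * s + (\<phi> (x + q) - 2 powi j * z)" by (simp add: algebra_simps)
        qed (use x' \<open>\<phi> x' < z\<close> in \<open>auto simp: dist_real_def\<close>)
      qed
      then show False using x' by simp
    qed
  qed simp
  moreover have "\<phi> ` ?B \<subseteq> {0..\<phi> c}" using nonneg(1) mono by (fastforce intro: less_imp_le)
  ultimately have "finite (\<phi> ` ?B)" by (simp add: Int_absorb1)
  moreover have "inj_on \<phi> ?B" by (rule inj_on_inverseI[of _ \<psi>]) (use inv in auto)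
  ultimately show ?thesis by (rule finite_imageD)
next
  case False
  then have "?B = {}" by auto
  then show ?thesis by (simp only: finite.emptyI)
qed

sublocale dyadic_cocycle jump
proof
  fix q r x :: real
  assume A: "q \<in> Dy" "r \<in> Dy" "x \<in> Dy" "0 \<le> q" "0 \<le> r" "0 < x"
  obtain i j where ij: "rslope q x i" "lslope q x j" using slopes_exist[of q x] A by metis
  obtain k l where kl: "rslope r (x + q) k" "lslope r (x + q) l"
    using slopes_exist[of r "x + q"] A by (metis add_pos_nonneg)
  have "rslope (q + r) x (i + k)" "lslope (q + r) x (j + l)"
    using rslope_add[OF ij(1) kl(1)] lslope_add[OF ij(2) kl(2)] A by auto
  then show "jump (q + r) x = jump q x + jump r (x + q)"
    using ij kl by (simp add: jumpI)
next
  fix q x :: real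
  assume A: "q \<in> Dy" "x \<in> Dy" "0 \<le> q" "0 < x"
  obtain i j where ij: "rslope q x i" "lslope q x j" using slopes_exist[of q x] A by metis
  then have "rslope (2 * q) (2 * x) i" "lslope (2 * q) (2 * x) j"
    using rslope_double lslope_double A by auto
  then show "jump (2 * q) (2 * x) = jump q x" using ij by (simp add: jumpI)
next
  show "finite {x \<in> Dy. 0 < x \<and> x < 1 \<and> jump 1 x \<noteq> 0}" by (rule finite_jumps) simp_all
qed

lemma scale: assumes "0 \<le> x" shows "\<phi> (2 powi k * x) = 2 powi k * \<phi> x"
proof -
  have up: "\<phi> (2 ^ n * x) = 2 ^ n * \<phi> x" if "0 \<le> x" for n :: nat and x
    using that double[of "2 ^ n * x" for n] by (induction n) (simp_all add: mult.assoc)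
  show ?thesis
  proof (cases "k \<ge> 0")
    case True
    then show ?thesis using up[OF assms, of "nat k"] by (simp add: power_int_def)
  next
    case False
    define n where "n = nat (- k)"
    have k: "k = - int n" using False by (simp add: n_def)
    have "\<phi> (2 ^ n * (2 powi k * x)) = 2 ^ n * \<phi> (2 powi k * x)" using assms by (intro up) simp
    moreover have "(2::real) ^ n * (2 powi k * x) = x" by (simp add: k power_int_minus)
    ultimately show ?thesis by (simp add: k power_int_minus field_simps)
  qed
qed

text \<open>Without jumps \<open>\<tau> 1\<close> is affine on the interval from \<open>0\<close> to
  \<open>\<phi> 1\<close>. It sends \<open>0\<close> to \<open>\<phi> 1\<close> and, by doubling,
  \<open>\<phi> 1\<close> to \<open>2 * \<phi> 1\<close>, so it is the translation by
  \<open>\<phi> 1\<close>. Together with doubling this fixes \<open>\<phi>\<close> on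
  \<open>Dy\<close>, and monotonicity does the rest.\<close>

lemma linear_if_trivial:
  assumes "\<not> nontrivial" obtains c where "c > 0" "\<And>x. 0 \<le> x \<Longrightarrow> \<phi> x = c * x"
proof -
  have no_jump: "jump 1 x = 0" if "x \<in> Dy" "0 < x" "x < 1" for x
    using assms that unfolding nontrivial_def by blast
  obtain i d where "rslope 1 0 i" and aff: "\<And>z. \<phi> 0 \<le> z \<Longrightarrow> z \<le> \<phi> 1 \<Longrightarrow> \<tau> 1 z = 2 powi i * z + d"
    by (rule affine_piece[of 1 0 1]) (use no_jump in auto)
  have "\<phi> 1 > 0" by (rule pos) simp
  have d: "d = \<phi> 1" using aff[of 0] \<tau>_\<phi>[of 0 1] \<open>\<phi> 1 > 0\<close> zero by simp
  have "2 * \<phi> 1 = 2 powi i * \<phi> 1 + \<phi> 1"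
    using aff[of "\<phi> 1"] \<tau>_\<phi>[of 1 1] double[of 1] \<open>\<phi> 1 > 0\<close> zero d by simp
  then have i: "(2::real) powi i = 1" using \<open>\<phi> 1 > 0\<close> by simp
  have shift: "\<phi> (x + 1) = \<phi> x + \<phi> 1" if "0 \<le> x" "x \<le> 1" for x
  proof -
    have "\<phi> x \<le> \<phi> 1" using that mono[of x 1] by (cases "x = 1") auto
    then show ?thesis using aff[of "\<phi> x"] \<tau>_\<phi>[of x 1] that nonneg zero i d by simp
  qed
  \<comment> \<open>\<open>k / 2 ^ Suc n\<close> is half of \<open>k / 2 ^ n\<close>, which lies
    between \<open>0\<close> and \<open>2\<close>; if it exceeds \<open>1\<close>, the unit shift
    brings it back to the range of the induction hypothesis.\<close>
  have unit: "\<phi> (real k / 2 ^ n) = \<phi> 1 * (real k / 2 ^ n)" if "k \<le> 2 ^ n" for k n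
    using that
  proof (induction n arbitrary: k)
    case 0
    then have "k = 0 \<or> k = 1" by auto
    then show ?case using zero by auto
  next
    case (Suc n)
    have half: "2 * (real k / 2 ^ Suc n) = real k / 2 ^ n" by simp
    have "\<phi> (real k / 2 ^ n) = \<phi> 1 * (real k / 2 ^ n)"
    proof (cases "k \<le> 2 ^ n")
      case False
      define m where "m = k - 2 ^ n"
      have m: "k = m + 2 ^ n" "m \<le> 2 ^ n" using False Suc.prems by (auto simp: m_def)
      have "real m \<le> 2 ^ n" using m(2) by (metis of_nat_le_iff of_nat_numeral of_nat_power)
      then have "\<phi> (real m / 2 ^ n + 1) = \<phi> (real m / 2 ^ n) + \<phi> 1" by (intro shift) auto
      moreover have "real k / 2 ^ n = real m / 2 ^ n + 1" by (simp add: m(1) add_divide_distrib)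
      ultimately show ?thesis using Suc.IH[OF m(2)] by (simp add: distrib_left)
    qed (rule Suc.IH)
    moreover have "\<phi> (real k / 2 ^ n) = 2 * \<phi> (real k / 2 ^ Suc n)"
      using double[of "real k / 2 ^ Suc n"] half by simp
    ultimately show ?case by simp
  qed
  have dyadic: "\<phi> x = \<phi> 1 * x" if x: "x \<in> Dy" "0 \<le> x" for x
  proof -
    obtain a b :: int where ab: "x = of_int a * 2 powi b" using x(1) by (auto simp: Dy_def)
    have "a \<ge> 0" using x(2) ab by (simp add: zero_le_mult_iff)
    define k where "k = nat a"
    have k: "x = real k * 2 powi b" using ab \<open>a \<ge> 0\<close> by (simp add: k_def)
    have "k < 2 ^ k" by (rule less_exp)
    have x_eq: "x = 2 powi (b + int k) * (real k / 2 ^ k)" by (simp add: k powi2_add)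
    have "\<phi> x = 2 powi (b + int k) * \<phi> (real k / 2 ^ k)" unfolding x_eq by (rule scale) simp
    also have "\<phi> (real k / 2 ^ k) = \<phi> 1 * (real k / 2 ^ k)" using \<open>k < 2 ^ k\<close> by (intro unit) simp
    finally show ?thesis by (simp add: x_eq)
  qed
  show ?thesis
  proof (rule that[OF \<open>\<phi> 1 > 0\<close>])
    fix x :: real assume x: "0 \<le> x"
    show "\<phi> x = \<phi> 1 * x"
    proof (rule linorder_cases[of "\<phi> x" "\<phi> 1 * x"])
      assume "\<phi> x < \<phi> 1 * x"
      then have "\<phi> x / \<phi> 1 < x" using \<open>\<phi> 1 > 0\<close> by (simp add: pos_divide_less_eq mult.commute)
      then obtain d where d: "d \<in> Dy" "\<phi> x / \<phi> 1 < d" "d < x" by (rule Dy_dense)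
      have "d \<ge> 0" using d(2) nonneg(1)[OF x] \<open>\<phi> 1 > 0\<close> by (meson divide_nonneg_pos less_imp_le order_trans)
      then have "\<phi> d < \<phi> x" using d mono by simp
      then show ?thesis using dyadic[OF d(1) \<open>d \<ge> 0\<close>] d(2) \<open>\<phi> 1 > 0\<close> by (simp add: pos_divide_less_eq mult.commute)
    next
      assume "\<phi> 1 * x < \<phi> x"
      then have "x < \<phi> x / \<phi> 1" using \<open>\<phi> 1 > 0\<close> by (simp add: pos_less_divide_eq mult.commute)
      then obtain d where d: "d \<in> Dy" "x < d" "d < \<phi> x / \<phi> 1" by (rule Dy_dense)
      have "\<phi> x < \<phi> d" using d x mono by simp
      then show ?thesis using dyadic[OF d(1)] d x \<open>\<phi> 1 > 0\<close> by (simp add: pos_less_divide_eq mult.commute)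
    qed
  qed
qed

end

section \<open>Incompatibility of two nontrivial cocycles\<close>

lemma between_grid_points:
  assumes "x \<in> grid w" "y \<in> grid w" "x < y" shows "x + 2 powi w \<le> y"
proof -
  obtain k m where km: "x = of_int k * 2 powi w" "y = of_int m * 2 powi w" using assms by (meson gridE)
  then have "k < m" using assms(3) by simp
  then have "real_of_int k + 1 \<le> of_int m" by simp
  then have "(real_of_int k + 1) * 2 powi w \<le> of_int m * 2 powi w" by (intro mult_right_mono) auto
  then show ?thesis by (simp add: km distrib_right)
qed

text \<open>The breaks of \<open>A.\<tau> 1\<close> are followed from left to right. The offset on
  the first piece fixes a valuation \<open>w0\<close>, and the images under \<open>\<phi>\<close> of
  all breaks turn out to have valuation below \<open>w0\<close>; yet some breaks
  \<open>2 ^ M * u\<close> have images \<open>2 ^ M * \<phi> u\<close> of valuation at least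
  \<open>w0\<close>.\<close>

lemma renorm_map_linear:
  assumes "renorm_map \<phi> \<psi>" "renorm_map \<psi> \<phi>"
  obtains c where "c > 0" "\<And>x. 0 \<le> x \<Longrightarrow> \<phi> x = c * x"
proof -
  interpret A: renorm_map \<phi> \<psi> by fact
  interpret B: renorm_map \<psi> \<phi> by fact
  have False if nA: A.nontrivial and nB: B.nontrivial
  proof -
    obtain i0 where i0: "A.rslope 1 0 i0" by (rule A.rslope_exists[of 1 0]) auto
    have "\<phi> 1 > 0" by (rule A.pos) simp
    moreover have "\<phi> 1 \<in> Dy" using A.Dy[of 1] by simp
    \<comment> \<open>Since \<open>\<phi> 0 = 0\<close>, the equation
      \<open>\<phi> 1 = 2 powi i0 * \<eta>\<close> determines the offset of the first piece;
      \<open>w0\<close> is its valuation.\<close>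
    ultimately obtain k0 w0 where k0: "odd k0" "2 powi (- i0) * \<phi> 1 = of_int k0 * 2 powi w0"
      using Dy_odd[of "2 powi (- i0) * \<phi> 1"] by (auto simp del: power_int_minus)
    \<comment> \<open>To the right of the break \<open>\<phi> x\<close> the map \<open>\<tau> 1\<close> is \<open>z \<mapsto> 2 powi i * (z + \<eta>)\<close>. The invariant is that the
      \<open>2\<close>-adic valuation \<open>w\<close> of \<open>\<eta>\<close> is at most that of \<open>\<phi> x\<close>, and at most \<open>w0\<close>.\<close>
    define good where "good x \<longleftrightarrow> (\<exists>i k w. odd k \<and> w \<le> w0 \<and> \<phi> x \<in> grid w \<and> A.rslope 1 x i \<and>
      \<phi> (x + 1) = 2 powi i * (\<phi> x + of_int k * 2 powi w))" for x
    have "\<phi> (0 + 1) = 2 powi i0 * (\<phi> 0 + of_int k0 * 2 powi w0)"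
      unfolding k0(2)[symmetric] by (simp add: A.zero power_int_minus)
    then have good0: "good 0"
      unfolding good_def using i0 k0(1) A.zero by (intro exI[of _ i0] exI[of _ k0] exI[of _ w0]) simp
    \<comment> \<open>Here \<open>c\<close> is the first break after \<open>a\<close>, and
      \<open>a\<close> is itself a break or \<open>0\<close>.\<close>
    have step: "good c \<and> \<phi> c \<notin> grid w0"
      if good: "good a" and ac: "0 \<le> a" "a < c" "c \<in> Dy" and c: "A.jump 1 c \<noteq> 0"
        and no_jump: "\<And>x. x \<in> Dy \<Longrightarrow> a < x \<Longrightarrow> x < c \<Longrightarrow> A.jump 1 x = 0" for a c
    proof -
      obtain i k w where k: "odd k" "w \<le> w0" "\<phi> a \<in> grid w" "A.rslope 1 a i"
        and \<phi>a: "\<phi> (a + 1) = 2 powi i * (\<phi> a + of_int k * 2 powi w)"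
        using good unfolding good_def by blast
      define \<eta> where "\<eta> = of_int k * (2::real) powi w"
      obtain i' d where i': "A.rslope 1 a i'"
        and aff: "\<And>z. \<phi> a \<le> z \<Longrightarrow> z \<le> \<phi> c \<Longrightarrow> A.\<tau> 1 z = 2 powi i' * z + d"
        by (rule A.affine_piece[of 1 a c]) (use ac no_jump in auto)
      have "i' = i" using A.rslope_unique[OF i' k(4)] .
      have \<phi>ac: "\<phi> a < \<phi> c" using A.mono ac by simp
      have a0: "0 \<le> \<phi> a" using A.nonneg ac by simp
      have "d = 2 powi i * \<eta>"
        using aff[of "\<phi> a"] \<phi>ac \<phi>a A.\<tau>_\<phi>[of a 1] ac \<open>i' = i\<close> by (simp add: \<eta>_def distrib_left)
      with aff \<open>i' = i\<close> have piece: "A.\<tau> 1 z = 2 powi i * (z + \<eta>)" if "\<phi> a \<le> z" "z \<le> \<phi> c" for z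
        using that by (simp add: distrib_left)
      \<comment> \<open>The offset may be negative, and \<open>\<psi>\<close> commutes with scaling
        only on the half line.\<close>
      have nonneg: "0 \<le> z + \<eta>" if "\<phi> a \<le> z" "z \<le> \<phi> c" for z
      proof -
        have "0 \<le> A.\<tau> 1 z" unfolding A.\<tau>_def using that a0 by (intro A.nonneg add_nonneg_nonneg) auto
        then show ?thesis using piece[OF that] by (simp add: zero_le_mult_iff)
      qed
      have conj: "\<psi> z + 1 = 2 powi i * \<psi> (z + \<eta>)" if "\<phi> a \<le> z" "z \<le> \<phi> c" for z
      proof -
        have "\<psi> (A.\<tau> 1 z) = \<psi> z + 1" unfolding A.\<tau>_def using that a0 A.nonneg(2)[of z] by (intro A.inv) simp
        moreover have "\<psi> (2 powi i * (z + \<eta>)) = 2 powi i * \<psi> (z + \<eta>)" by (rule B.scale) (rule nonneg[OF that])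
        ultimately show ?thesis using piece[OF that] by simp
      qed
      \<comment> \<open>On an affine piece of \<open>\<tau> 1\<close> the map \<open>\<psi>\<close> conjugates translation by \<open>\<eta>\<close> to an affine map, so a long
        piece contradicts \<open>jump_in_every_gap\<close> for \<open>\<psi>\<close>.\<close>
      have short: "\<phi> c < \<phi> a + 2 powi w"
      proof (rule ccontr)
        assume long: "\<not> \<phi> c < \<phi> a + 2 powi w"
        show False
        proof (cases "k > 0")
          case True
          then obtain z where z: "z \<in> Dy" "\<phi> a < z" "z < \<phi> a + 2 powi w" "B.jump \<eta> z \<noteq> 0"
            by (rule B.jump_in_every_gap[OF nB k(1) _ \<eta>_def k(3) a0])
          have "B.jump \<eta> z = 0"
          proof (rule B.jump_affine[of a c \<eta> "- i" "2 powi (- i)"])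
            fix x assume x: "a < x" "x < c"
            then have "\<phi> a \<le> \<phi> x" "\<phi> x \<le> \<phi> c" using ac A.mono by (auto intro: less_imp_le)
            from conj[OF this] show "B.\<tau> \<eta> x = 2 powi - i * x + 2 powi - i"
              using x ac by (simp add: B.\<tau>_def A.inv power_int_minus field_simps)
          qed (use z long a0 ac in \<open>auto simp: A.\<psi>_less_iff\<close>)
          then show False using z(4) by simp
        next
          case False
          \<comment> \<open>For a negative offset the inverse translation, by
            \<open>- \<eta>\<close>, is used instead; its piece starts at
            \<open>\<phi> a + \<eta>\<close>, again a point of \<open>grid w\<close>, and has the
            same length.\<close>
          then have "- k > 0" "odd (- k)" using k(1) by (auto simp: not_less order_le_less)
          moreover have "- \<eta> = of_int (- k) * 2 powi w" by (simp add: \<eta>_def)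
          moreover have grid: "\<phi> a + \<eta> \<in> grid w" by (intro grid_add k gridI[of \<eta> k] \<eta>_def)
          moreover have a\<eta>: "0 \<le> \<phi> a + \<eta>" using nonneg \<phi>ac by simp
          ultimately obtain z where z: "z \<in> Dy" "\<phi> a + \<eta> < z" "z < \<phi> a + \<eta> + 2 powi w" "B.jump (- \<eta>) z \<noteq> 0"
            by (metis B.jump_in_every_gap[OF nB])
          have c\<eta>: "0 \<le> \<phi> c + \<eta>" using nonneg \<phi>ac by simp
          have "B.jump (- \<eta>) z = 0"
          proof (rule B.jump_affine[of "\<psi> (\<phi> a + \<eta>)" "\<psi> (\<phi> c + \<eta>)" "- \<eta>" i "- 1"])
            fix x assume x: "\<psi> (\<phi> a + \<eta>) < x" "x < \<psi> (\<phi> c + \<eta>)"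
            then have x0: "0 \<le> x" using A.nonneg(2)[OF a\<eta>] by simp
            then have "\<phi> a \<le> \<phi> x - \<eta>" "\<phi> x - \<eta> \<le> \<phi> c"
              using x a\<eta> c\<eta> by (auto simp: A.\<psi>_less_iff)
            from conj[OF this] show "B.\<tau> (- \<eta>) x = 2 powi i * x + - 1"
              using x0 by (simp add: B.\<tau>_def A.inv)
          qed (use z long a\<eta> c\<eta> in \<open>auto intro: B.mono\<close>)
          then show False using z(4) by simp
        qed
      qed
      \<comment> \<open>Distinct points of \<open>grid w\<close> are at least
        \<open>2 powi w\<close> apart, so a piece shorter than this ends outside the grid: the
        valuation \<open>v\<close> of \<open>\<phi> c\<close> is below \<open>w\<close>.\<close>
      have "\<phi> c \<notin> grid w" using between_grid_points[OF k(3) _ \<phi>ac] short by auto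
      moreover have "\<phi> c \<in> Dy" "\<phi> c \<noteq> 0" using A.Dy[of c] ac a0 \<phi>ac by auto
      ultimately obtain p v where p: "odd p" "\<phi> c = of_int p * 2 powi v" "v < w"
        using Dy_odd[of "\<phi> c"] odd_in_grid_iff by (metis not_le)
      have notin: "\<phi> c \<notin> grid w0" using \<open>\<phi> c \<notin> grid w\<close> grid_mono k(2) by blast
      obtain i2 j where ij: "A.rslope 1 c i2" "A.lslope 1 c j" using A.slopes_exist[of 1 c] ac by auto
      have val_c: "\<phi> (c + 1) = 2 powi i * (\<phi> c + \<eta>)" using piece[of "\<phi> c"] \<phi>ac A.\<tau>_\<phi>[of c 1] ac by simp
      have "A.lslope 1 c i"
        unfolding A.lslope_def val_c
      proof (intro exI[of _ "\<phi> c - \<phi> a"] conjI ballI)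
        fix t assume "t \<in> {0..\<phi> c - \<phi> a}"
        then show "A.\<tau> 1 (\<phi> c - t) = 2 powi i * (\<phi> c + \<eta>) - 2 powi i * t"
          using piece[of "\<phi> c - t"] by (simp add: algebra_simps)
      qed (use \<phi>ac a0 in auto)
      then have "i2 \<noteq> i" using A.jumpI[OF ij(1)] c by auto
      \<comment> \<open>Because \<open>v < w\<close>, adding \<open>\<eta>\<close> changes the
        numerator of \<open>\<phi> c\<close> by an even number, so it stays odd.\<close>
      define p' where "p' = p + k * 2 ^ nat (w - v)"
      have "odd p'" using p by (simp add: p'_def)
      have "(2::real) powi w = of_int (2 ^ nat (w - v)) * 2 powi v"
        using p(3) powi2_add[of "w - v" v] by (simp only: powi2_nonneg_int[of "w - v", symmetric]) simp
      then have c\<eta>: "\<phi> c + \<eta> = of_int p' * 2 powi v" by (simp add: p(2) \<eta>_def p'_def distrib_right)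
      \<comment> \<open>The next offset \<open>\<eta>'\<close> solves \<open>2 powi i2 * (\<phi> c +
        \<eta>') = 2 powi i * (\<phi> c + \<eta>)\<close>, so it is
        \<open>(2 powi (i - i2) * p' - p) * 2 powi v\<close>. As \<open>i2 \<noteq> i\<close>, after
        clearing the denominator exactly one of the odd numbers \<open>p\<close> and
        \<open>p'\<close> carries an even factor, and the difference is odd. This is where a genuine
        jump at \<open>c\<close> enters: with equal slopes the parity would be lost.\<close>
      have "good c"
      proof (cases "i2 < i")
        case True
        define k2 where "k2 = 2 ^ nat (i - i2) * p' - p"
        have "(2::real) powi i = 2 powi i2 * of_int (2 ^ nat (i - i2))"
          using True powi2_add[of i2 "i - i2"] by (simp only: powi2_nonneg_int[of "i - i2", symmetric]) simp
        then have "\<phi> (c + 1) = 2 powi i2 * (\<phi> c + of_int k2 * 2 powi v)"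
          unfolding val_c c\<eta> by (simp add: p(2) k2_def algebra_simps)
        moreover have "odd k2" using True p(1) by (simp add: k2_def)
        ultimately show ?thesis unfolding good_def using ij(1) p k(2) odd_in_grid_iff[OF p(1), of v v]
          by (intro exI[of _ i2] exI[of _ k2] exI[of _ v]) auto
      next
        case False
        then have "i < i2" using \<open>i2 \<noteq> i\<close> by simp
        define k2 where "k2 = p' - 2 ^ nat (i2 - i) * p"
        define v2 where "v2 = v - (i2 - i)"
        have pw: "(2::real) powi v = of_int (2 ^ nat (i2 - i)) * 2 powi v2" "(2::real) powi i2 = 2 powi i * of_int (2 ^ nat (i2 - i))"
          using \<open>i < i2\<close> powi2_add[of "i2 - i" v2] powi2_add[of i "i2 - i"]
          by (simp_all only: powi2_nonneg_int[of "i2 - i", symmetric]) (simp_all add: v2_def)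
        have "\<phi> (c + 1) = 2 powi i2 * (\<phi> c + of_int k2 * 2 powi v2)"
          unfolding val_c c\<eta> pw by (simp add: p(2) pw k2_def algebra_simps)
        moreover have "odd k2" using \<open>i < i2\<close> \<open>odd p'\<close> by (simp add: k2_def)
        moreover have "\<phi> c \<in> grid v2" "v2 \<le> w0"
          using p k(2) \<open>i < i2\<close> odd_in_grid_iff[OF p(1), of v v2] by (auto simp: v2_def)
        ultimately show ?thesis unfolding good_def using ij(1) by blast
      qed
      with notin show ?thesis by blast
    qed
    define S where "S c = {x \<in> Dy. 0 < x \<and> x < c \<and> A.jump 1 x \<noteq> 0}" for c
    have fin: "finite (S c)" for c unfolding S_def by (rule A.finite_jumps) auto
    \<comment> \<open>Induction on the number of earlier breaks; the piece ending at
      \<open>c\<close> starts at the largest of them, or at \<open>0\<close> if there is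
      none.\<close>
    have all_good: "good c \<and> \<phi> c \<notin> grid w0" if "c \<in> Dy" "0 < c" "A.jump 1 c \<noteq> 0" for c
      using that
    proof (induction "card (S c)" arbitrary: c rule: less_induct)
      case less
      show ?case
      proof (cases "S c = {}")
        case True
        then show ?thesis using less.prems by (intro step[OF good0]) (auto simp: S_def)
      next
        case False
        define a where "a = Max (S c)"
        have a: "a \<in> S c" unfolding a_def by (rule Max_in[OF fin False])
        then have "S a \<subset> S c" by (auto simp: S_def)
        then have "card (S a) < card (S c)" by (rule psubset_card_mono[OF fin])
        then have "good a" using less.hyps a by (auto simp: S_def)
        moreover have "A.jump 1 x = 0" if "x \<in> Dy" "a < x" "x < c" for x
        proof (rule ccontr)
          assume "A.jump 1 x \<noteq> 0"
          then have "x \<in> S c" using that a by (auto simp: S_def)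
          then have "x \<le> a" unfolding a_def by (rule Max_ge[OF fin])
          then show False using that by simp
        qed
        ultimately show ?thesis using less.prems a by (intro step[of a c]) (auto simp: S_def)
      qed
    qed
    obtain u where u: "odd u" "\<And>N. \<exists>M\<ge>N. A.jump 1 (2 ^ M * real u) \<noteq> 0"
      using A.jump_at_highly_divisible[OF nA] by metis
    have "\<phi> (real u) \<in> Dy" using A.Dy[of "real u"] by simp
    then obtain v where v: "\<phi> (real u) \<in> grid v" by (rule DyE_grid)
    \<comment> \<open>Scaling by \<open>2 ^ M\<close> raises the valuation of the image by
      \<open>M\<close>, so \<open>M \<ge> w0 - v\<close> is enough to reach
      \<open>grid w0\<close>.\<close>
    obtain M where M: "M \<ge> nat (w0 - v)" "A.jump 1 (2 ^ M * real u) \<noteq> 0" using u(2) by blast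
    have "2 ^ M * real u \<in> Dy" using Dy_of_nat[of "2 ^ M * u"] by simp
    moreover have "0 < 2 ^ M * real u" using u(1) by (simp add: odd_pos)
    ultimately have "\<phi> (2 ^ M * real u) \<notin> grid w0" using all_good M(2) by blast
    moreover have "\<phi> (2 ^ M * real u) = 2 powi (int M) * \<phi> (real u)" using A.scale[of "real u" "int M"] by simp
    moreover have "\<dots> \<in> grid w0" by (rule grid_mono[OF grid_scale[OF v]]) (use M(1) in linarith)
    ultimately show False by simp
  qed
  then consider "\<not> A.nontrivial" | "\<not> B.nontrivial" by blast
  then show ?thesis
  proof cases
    case 1
    then show ?thesis using A.linear_if_trivial that by metis
  next
    case 2
    then obtain c where c: "c > 0" "\<And>y. 0 \<le> y \<Longrightarrow> \<psi> y = c * y" using B.linear_if_trivial by metis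
    show ?thesis
    proof (rule that[of "1 / c"])
      fix x :: real assume "0 \<le> x"
      then show "\<phi> x = 1 / c * x" using c(2)[of "\<phi> x"] A.inv(1)[of x] A.nonneg(1)[of x] c(1) by (simp add: field_simps)
    qed (use c in simp)
  qed
qed

subsection \<open>The normaliser of the dyadic PL group of the line\<close>

text \<open>Continuity is implied, since an increasing surjection of the line has no gaps in its
  range.\<close>

definition dyadic_auto :: "(real \<Rightarrow> real) \<Rightarrow> bool" where
  "dyadic_auto f \<longleftrightarrow> strict_mono f \<and> surj f \<and> (\<forall>x. f x \<in> Dy \<longleftrightarrow> x \<in> Dy)"

text \<open>One-sided expansions at every point encode local finiteness of the breaks as well as
  linearity between them; the last clause confines breaks to \<open>Dy\<close>.\<close>

definition pl_at :: "(real \<Rightarrow> real) \<Rightarrow> real \<Rightarrow> bool" where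
  "pl_at f x \<longleftrightarrow> (\<exists>e>0. \<exists>i j :: int.
     (\<forall>t\<in>{0..e}. f (x + t) = f x + 2 powi i * t \<and> f (x - t) = f x - 2 powi j * t) \<and> (x \<notin> Dy \<longrightarrow> i = j))"

definition PL2 :: "(real \<Rightarrow> real) set" where
  "PL2 = {f. dyadic_auto f \<and> (\<forall>x. pl_at f x)}"

definition aff :: "int \<Rightarrow> real \<Rightarrow> real \<Rightarrow> real" where
  "aff i d x = 2 powi i * x + d"

definition normaliser :: "(real \<Rightarrow> real) \<Rightarrow> bool" where
  "normaliser h \<longleftrightarrow> dyadic_auto h \<and> (\<forall>f\<in>PL2. h \<circ> f \<circ> inv h \<in> PL2 \<and> inv h \<circ> f \<circ> h \<in> PL2)"

lemma dyadic_auto_less: "dyadic_auto f \<Longrightarrow> f x < f y \<longleftrightarrow> x < y"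
  by (simp add: dyadic_auto_def strict_mono_less)

lemma dyadic_auto_le: "dyadic_auto f \<Longrightarrow> f x \<le> f y \<longleftrightarrow> x \<le> y"
  by (simp add: dyadic_auto_def strict_mono_less_eq)

lemma dyadic_auto_Dy: "dyadic_auto f \<Longrightarrow> f x \<in> Dy \<longleftrightarrow> x \<in> Dy"
  by (simp add: dyadic_auto_def)

lemma dyadic_auto_bij: "dyadic_auto f \<Longrightarrow> bij f"
  by (simp add: dyadic_auto_def bij_def strict_mono_imp_inj_on)

lemma dyadic_auto_inv_f: "dyadic_auto f \<Longrightarrow> inv f (f x) = x"
  by (simp add: dyadic_auto_bij bij_is_inj)

lemma dyadic_auto_f_inv: "dyadic_auto f \<Longrightarrow> f (inv f y) = y"
  by (simp add: dyadic_auto_def surj_f_inv_f)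

lemma dyadic_auto_inv: assumes "dyadic_auto f" shows "dyadic_auto (inv f)"
proof -
  have "inv f x < inv f y" if "x < y" for x y
    using that dyadic_auto_less[OF assms, of "inv f x" "inv f y"] dyadic_auto_f_inv[OF assms] by simp
  then have "strict_mono (inv f)" by (simp add: strict_mono_def)
  moreover have "surj (inv f)" using dyadic_auto_bij[OF assms] by (simp add: bij_imp_bij_inv bij_is_surj)
  moreover have "inv f x \<in> Dy \<longleftrightarrow> x \<in> Dy" for x
    using dyadic_auto_Dy[OF assms, of "inv f x"] dyadic_auto_f_inv[OF assms] by simp
  ultimately show ?thesis by (simp add: dyadic_auto_def)
qed

lemma dyadic_auto_inv_inv: "dyadic_auto f \<Longrightarrow> inv (inv f) = f"
  by (simp add: dyadic_auto_bij inv_inv_eq)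

lemma dyadic_auto_comp: assumes "dyadic_auto f" "dyadic_auto g" shows "dyadic_auto (f \<circ> g)"
proof -
  have "surj (f \<circ> g)" using assms by (intro comp_surj) (auto simp: dyadic_auto_def)
  then show ?thesis using assms by (simp add: dyadic_auto_def strict_mono_def)
qed

lemma dyadic_auto_inv_comp:
  assumes "dyadic_auto f" "dyadic_auto g" shows "inv (f \<circ> g) = inv g \<circ> inv f"
  using assms by (intro o_inv_distrib dyadic_auto_bij)

lemma PL2_dyadic_auto: "f \<in> PL2 \<Longrightarrow> dyadic_auto f"
  by (simp add: PL2_def)

lemma PL2_pl_at: "f \<in> PL2 \<Longrightarrow> pl_at f x"
  by (simp add: PL2_def)

lemma PL2I: "dyadic_auto f \<Longrightarrow> (\<And>x. pl_at f x) \<Longrightarrow> f \<in> PL2"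
  unfolding PL2_def by blast

lemma pl_atI:
  assumes "e > 0" "\<And>t. 0 \<le> t \<Longrightarrow> t \<le> e \<Longrightarrow> f (x + t) = f x + 2 powi i * t"
    "\<And>t. 0 \<le> t \<Longrightarrow> t \<le> e \<Longrightarrow> f (x - t) = f x - 2 powi j * t" "x \<notin> Dy \<Longrightarrow> i = j"
  shows "pl_at f x"
  unfolding pl_at_def using assms by (intro exI[of _ e] exI[of _ i] exI[of _ j]) auto

lemma PL2_comp: assumes "g \<in> PL2" "f \<in> PL2" shows "g \<circ> f \<in> PL2"
proof -
  have f: "dyadic_auto f" and g: "dyadic_auto g" using assms by (auto simp: PL2_def)
  have "pl_at (g \<circ> f) x" for x
  proof -
    obtain e i j where e: "e > 0"
      "\<forall>t\<in>{0..e}. f (x + t) = f x + 2 powi i * t"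
      "\<forall>t\<in>{0..e}. f (x - t) = f x - 2 powi j * t"
      "x \<notin> Dy \<longrightarrow> i = j"
      using PL2_pl_at[OF assms(2), of x] unfolding pl_at_def by blast
    obtain e' i' j' where e': "e' > 0" "\<forall>t\<in>{0..e'}. g (f x + t) = g (f x) + 2 powi i' * t \<and> g (f x - t) = g (f x) - 2 powi j' * t"
      "f x \<notin> Dy \<longrightarrow> i' = j'"
      using PL2_pl_at[OF assms(1), of "f x"] unfolding pl_at_def by blast
    show ?thesis
    proof (rule pl_atI[of "min e (min (e' / 2 powi i) (e' / 2 powi j))" _ _ "i + i'" "j + j'"])
      fix t assume t: "0 \<le> t" "t \<le> min e (min (e' / 2 powi i) (e' / 2 powi j))"
      then have "t \<in> {0..e}" "2 powi i * t \<in> {0..e'}" "2 powi j * t \<in> {0..e'}"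
        by (auto simp: pos_le_divide_eq mult.commute)
      then have "f (x + t) = f x + 2 powi i * t" "f (x - t) = f x - 2 powi j * t"
        "g (f x + 2 powi i * t) = g (f x) + 2 powi i' * (2 powi i * t)"
        "g (f x - 2 powi j * t) = g (f x) - 2 powi j' * (2 powi j * t)"
        using e(2,3) e'(2) by blast+
      then show "(g \<circ> f) (x + t) = (g \<circ> f) x + 2 powi (i + i') * t" "(g \<circ> f) (x - t) = (g \<circ> f) x - 2 powi (j + j') * t"
        by (simp_all add: powi2_add)
    qed (use e(1,4) e'(1,3) dyadic_auto_Dy[OF f, of x] in auto)
  qed
  then show ?thesis by (intro PL2I dyadic_auto_comp[OF g f])
qed

lemma PL2_inv: assumes "f \<in> PL2" shows "inv f \<in> PL2"
proof -
  have f: "dyadic_auto f" using assms by (simp add: PL2_def)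
  have "pl_at (inv f) y" for y
  proof -
    define x where "x = inv f y"
    have y: "y = f x" by (simp add: x_def dyadic_auto_f_inv[OF f])
    obtain e i j where e: "e > 0"
      "\<forall>t\<in>{0..e}. f (x + t) = f x + 2 powi i * t"
      "\<forall>t\<in>{0..e}. f (x - t) = f x - 2 powi j * t"
      "x \<notin> Dy \<longrightarrow> i = j"
      using PL2_pl_at[OF assms, of x] unfolding pl_at_def by blast
    show ?thesis
    proof (rule pl_atI[of "min (e * 2 powi i) (e * 2 powi j)" _ _ "- i" "- j"])
      fix t assume t: "0 \<le> t" "t \<le> min (e * 2 powi i) (e * 2 powi j)"
      have "f (x + 2 powi (- i) * t) = y + t"
        using e(2)[rule_format, of "2 powi (- i) * t"] t by (simp add: y power_int_minus field_simps)
      then show "inv f (y + t) = inv f y + 2 powi (- i) * t"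
        using dyadic_auto_inv_f[OF f] by (metis x_def)
      have "f (x - 2 powi (- j) * t) = y - t"
        using e(3)[rule_format, of "2 powi (- j) * t"] t by (simp add: y power_int_minus field_simps)
      then show "inv f (y - t) = inv f y - 2 powi (- j) * t"
        using dyadic_auto_inv_f[OF f] by (metis x_def)
    qed (use e(1,4) dyadic_auto_Dy[OF f, of x] in \<open>auto simp: y\<close>)
  qed
  then show ?thesis by (intro PL2I dyadic_auto_inv[OF f])
qed

lemma aff_PL2: assumes "d \<in> Dy" shows "aff i d \<in> PL2"
proof -
  have "strict_mono (aff i d)" by (simp add: strict_mono_def aff_def)
  moreover have "surj (aff i d)"
    by (rule surjI[of _ "\<lambda>y. 2 powi (- i) * (y - d)"]) (simp add: aff_def power_int_minus flip: mult.assoc)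
  moreover have "aff i d x \<in> Dy \<longleftrightarrow> x \<in> Dy" for x
    using Dy_add_iff[OF assms] by (simp add: aff_def)
  moreover have "pl_at (aff i d) x" for x
    by (rule pl_atI[of 1 _ _ i i]) (auto simp: aff_def algebra_simps)
  ultimately show ?thesis by (intro PL2I) (auto simp: dyadic_auto_def)
qed

lemma aff_comp: "aff i d \<circ> aff j c = aff (i + j) (2 powi i * c + d)"
  by (auto simp: aff_def powi2_add algebra_simps)

lemma conj_comp:
  assumes "dyadic_auto h" shows "h \<circ> (f \<circ> g) \<circ> inv h = (h \<circ> f \<circ> inv h) \<circ> (h \<circ> g \<circ> inv h)"
  using dyadic_auto_inv_f[OF assms] by (auto simp: fun_eq_iff)

text \<open>Near each point an element of \<open>PL2\<close> is, on either side, one of the affine maps \<open>aff i d\<close>,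
  so it is enough to conjugate these.\<close>

lemma conj_PL2I:
  assumes h: "dyadic_auto h" and aff: "\<And>i d. d \<in> Dy \<Longrightarrow> h \<circ> aff i d \<circ> inv h \<in> PL2" and f: "f \<in> PL2"
  shows "h \<circ> f \<circ> inv h \<in> PL2"
proof -
  have hi: "dyadic_auto (inv h)" by (rule dyadic_auto_inv[OF h])
  have fo: "dyadic_auto f" using f by (rule PL2_dyadic_auto)
  have "pl_at (h \<circ> f \<circ> inv h) y" for y
  proof -
    define x where "x = inv h y"
    have y: "y = h x" by (simp add: x_def dyadic_auto_f_inv[OF h])
    obtain e i j where e: "e > 0"
      "\<forall>t\<in>{0..e}. f (x + t) = f x + 2 powi i * t"
      "\<forall>t\<in>{0..e}. f (x - t) = f x - 2 powi j * t"
      "x \<notin> Dy \<longrightarrow> i = j"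
      using PL2_pl_at[OF f, of x] unfolding pl_at_def by blast
    define d c where "d = f x - 2 powi i * x" and "c = f x - 2 powi j * x"
    have fd: "f s = aff i d s" if "x \<le> s" "s \<le> x + e" for s
    proof -
      have "f (x + (s - x)) = f x + 2 powi i * (s - x)" using that by (intro e(2)[rule_format]) auto
      then show ?thesis by (simp add: aff_def d_def right_diff_distrib)
    qed
    have fc: "f s = aff j c s" if "x - e \<le> s" "s \<le> x" for s
    proof -
      have "f (x - (x - s)) = f x - 2 powi j * (x - s)" using that by (intro e(3)[rule_format]) auto
      then show ?thesis by (simp add: aff_def c_def right_diff_distrib)
    qed
    \<comment> \<open>The intercept of a piece is dyadic because \<open>f\<close> and scaling
      preserve \<open>Dy\<close> and each piece contains a dyadic test point.\<close>
    have Dy_if: "b \<in> Dy" if "s \<in> Dy" "f s = aff k b s" for b k s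
    proof -
      have "b = f s - 2 powi k * s" using that(2) by (simp add: aff_def)
      moreover have "f s \<in> Dy" using that(1) dyadic_auto_Dy[OF fo] by blast
      ultimately show ?thesis using that(1) by (simp only: Dy_diff Dy_scale)
    qed
    obtain s where "s \<in> Dy" "x < s" "s < x + e" using Dy_dense[of x "x + e"] e(1) by auto
    then have "d \<in> Dy" using Dy_if[of s i d] fd[of s] by simp
    obtain s where "s \<in> Dy" "x - e < s" "s < x" using Dy_dense[of "x - e" x] e(1) by auto
    then have "c \<in> Dy" using Dy_if[of s j c] fc[of s] by simp
    \<comment> \<open>At a dyadic point the two sides may be conjugates of different affine maps.
      Elsewhere both sides come from a single one, so its conjugate yields the equality of slopes
      required there.\<close>
    have same: "aff j c = aff i d" if "y \<notin> Dy"
    proof -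
      have "i = j" using e(4) that dyadic_auto_Dy[OF h, of x] by (simp add: y)
      then show ?thesis by (simp add: d_def c_def)
    qed
    let ?F = "h \<circ> aff i d \<circ> inv h" and ?G = "h \<circ> aff j c \<circ> inv h"
    have "pl_at ?F y" by (rule PL2_pl_at[OF aff[OF \<open>d \<in> Dy\<close>]])
    then obtain e2 i2 j2 where 2: "e2 > 0"
      "\<forall>t\<in>{0..e2}. ?F (y + t) = ?F y + 2 powi i2 * t \<and> ?F (y - t) = ?F y - 2 powi j2 * t" "y \<notin> Dy \<longrightarrow> i2 = j2"
      unfolding pl_at_def by (elim exE conjE)
    have "pl_at ?G y" by (rule PL2_pl_at[OF aff[OF \<open>c \<in> Dy\<close>]])
    then obtain e3 i3 j3 where 3: "e3 > 0"
      "\<forall>t\<in>{0..e3}. ?G (y + t) = ?G y + 2 powi i3 * t \<and> ?G (y - t) = ?G y - 2 powi j3 * t" "y \<notin> Dy \<longrightarrow> i3 = j3"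
      unfolding pl_at_def by (elim exE conjE)
    obtain e1 i1 j1 where e1: "e1 > 0" "\<And>t. t \<in> {0..e1} \<Longrightarrow> ?F (y + t) = ?F y + 2 powi i1 * t"
      "\<And>t. t \<in> {0..e1} \<Longrightarrow> ?G (y - t) = ?G y - 2 powi j1 * t" "y \<notin> Dy \<longrightarrow> i1 = j1"
    proof (cases "y \<in> Dy")
      case True
      show ?thesis
      proof (rule that[of "min e2 e3" i2 j3])
        fix t assume "t \<in> {0..min e2 e3}"
        then have "t \<in> {0..e2}" "t \<in> {0..e3}" by auto
        then show "?F (y + t) = ?F y + 2 powi i2 * t" "?G (y - t) = ?G y - 2 powi j3 * t" using 2(2) 3(2) by blast+
      qed (use 2(1) 3(1) True in auto)
    next
      case False
      have "?G = ?F" by (simp only: same[OF False])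
      show ?thesis unfolding \<open>?G = ?F\<close>
      proof (rule that[of e2 i2 j2, unfolded \<open>?G = ?F\<close>])
        fix t assume "t \<in> {0..e2}"
        then show "?F (y + t) = ?F y + 2 powi i2 * t" "?F (y - t) = ?F y - 2 powi j2 * t" using 2(2) by blast+
      qed (use 2 in auto)
    qed
    define e' where "e' = min e1 (min (h (x + e) - y) (y - h (x - e)))"
    have base: "(h \<circ> f \<circ> inv h) y = (h \<circ> aff i d \<circ> inv h) y" "(h \<circ> f \<circ> inv h) y = (h \<circ> aff j c \<circ> inv h) y"
      using fd[of x] fc[of x] e(1) by (auto simp: x_def)
    show ?thesis
    proof (rule pl_atI[of e' _ _ i1 j1])
      have "h (x - e) < h x" "h x < h (x + e)" using e(1) by (auto simp: dyadic_auto_less[OF h])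
      then show "e' > 0" using e1(1) by (simp add: e'_def y)
    next
      fix t assume t: "0 \<le> t" "t \<le> e'"
      have "x \<le> inv h (y + t)" unfolding x_def using t by (simp add: dyadic_auto_le[OF hi])
      moreover have "inv h (y + t) \<le> inv h (h (x + e))" unfolding dyadic_auto_le[OF hi] using t by (simp add: e'_def)
      ultimately have "(h \<circ> f \<circ> inv h) (y + t) = (h \<circ> aff i d \<circ> inv h) (y + t)"
        using fd by (simp add: dyadic_auto_inv_f[OF h])
      then show "(h \<circ> f \<circ> inv h) (y + t) = (h \<circ> f \<circ> inv h) y + 2 powi i1 * t"
        using e1(2)[of t] t base(1) by (simp add: e'_def)
      have "inv h (y - t) \<le> x" unfolding x_def using t by (simp add: dyadic_auto_le[OF hi])
      moreover have "inv h (h (x - e)) \<le> inv h (y - t)" unfolding dyadic_auto_le[OF hi] using t by (simp add: e'_def)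
      ultimately have "(h \<circ> f \<circ> inv h) (y - t) = (h \<circ> aff j c \<circ> inv h) (y - t)"
        using fc by (simp add: dyadic_auto_inv_f[OF h])
      then show "(h \<circ> f \<circ> inv h) (y - t) = (h \<circ> f \<circ> inv h) y - 2 powi j1 * t"
        using e1(3)[of t] t base(2) by (simp add: e'_def)
    qed (use e1(4) in blast)
  qed
  then show ?thesis by (intro PL2I dyadic_auto_comp h hi fo)
qed

text \<open>With \<open>D\<close> the doubling and \<open>T\<close> the unit translation, the affine
  map of slope \<open>2 powi i\<close> and intercept \<open>a * 2 powi b\<close> is
  \<open>D^b T^a D^(i - b)\<close>. Conjugation by \<open>h\<close> fixes \<open>T\<close> and, by
  hypothesis, sends \<open>D\<close> into the group \<open>PL2\<close>.\<close>

lemma conj_aff_PL2: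
  assumes h: "dyadic_auto h" and shift: "\<And>x. h (x + 1) = h x + 1" and dbl: "h \<circ> aff 1 0 \<circ> inv h \<in> PL2" and "d \<in> Dy"
  shows "h \<circ> aff i d \<circ> inv h \<in> PL2"
proof -
  have nat_scale: "h \<circ> aff (int n) 0 \<circ> inv h \<in> PL2" for n
  proof (induction n)
    case 0
    have "h \<circ> aff (int 0) 0 \<circ> inv h = aff 0 0" using dyadic_auto_f_inv[OF h] by (auto simp: aff_def)
    then show ?case using aff_PL2[of 0 0] by (simp del: comp_apply)
  next
    case (Suc n)
    have "aff (int (Suc n)) 0 = aff 1 0 \<circ> aff (int n) 0" by (simp add: aff_comp)
    then show ?case using PL2_comp[OF dbl Suc] by (simp only: conj_comp[OF h])
  qed
  have scale: "h \<circ> aff k 0 \<circ> inv h \<in> PL2" for k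
  proof (cases "k \<ge> 0")
    case True
    then show ?thesis using nat_scale[of "nat k"] by simp
  next
    case False
    let ?f = "h \<circ> aff (int (nat (- k))) 0 \<circ> inv h"
    have "inv ?f = h \<circ> aff k 0 \<circ> inv h"
    proof (rule inv_equality)
      fix x
      have "aff k 0 (aff (- k) 0 z) = z" "aff (- k) 0 (aff k 0 z) = z" for z
        by (simp_all add: aff_def power_int_minus)
      then show "(h \<circ> aff k 0 \<circ> inv h) (?f x) = x" "?f ((h \<circ> aff k 0 \<circ> inv h) x) = x"
        using False dyadic_auto_inv_f[OF h] dyadic_auto_f_inv[OF h] by simp_all
    qed
    then show ?thesis using PL2_inv[OF nat_scale[of "nat (- k)"]] by simp
  qed
  have shift_nat: "h (x + real n) = h x + real n" for x n
    by (induction n) (use shift in \<open>simp_all add: add.assoc[symmetric] add.commute[of 1]\<close>)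
  have shift_int: "h (x + of_int m) = h x + of_int m" for x m
  proof (cases "m \<ge> 0")
    case True
    then show ?thesis using shift_nat[of x "nat m"] by simp
  next
    case False
    then show ?thesis using shift_nat[of "x + of_int m" "nat (- m)"] by simp
  qed
  obtain a b :: int where ab: "d = of_int a * 2 powi b" using \<open>d \<in> Dy\<close> by (auto simp: Dy_def)
  have "h \<circ> aff 0 (of_int a) \<circ> inv h = aff 0 (of_int a)"
    using shift_int dyadic_auto_f_inv[OF h] by (auto simp: aff_def)
  then have int: "h \<circ> aff 0 (of_int a) \<circ> inv h \<in> PL2" using aff_PL2[of "of_int a" 0] by simp
  have "aff i d = aff b 0 \<circ> (aff 0 (of_int a) \<circ> aff (i - b) 0)" by (simp add: aff_comp ab mult.commute)
  then show ?thesis by (simp only: conj_comp[OF h]) (intro PL2_comp scale int)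
qed

lemma normaliserI:
  assumes h: "dyadic_auto h" and shift: "\<And>x. h (x + 1) = h x + 1"
    and dbl: "h \<circ> aff 1 0 \<circ> inv h \<in> PL2" "inv h \<circ> aff 1 0 \<circ> h \<in> PL2"
  shows "normaliser h"
proof -
  have hi: "dyadic_auto (inv h)" and hii: "inv (inv h) = h"
    by (rule dyadic_auto_inv[OF h], rule dyadic_auto_inv_inv[OF h])
  have "inv h (x + 1) = inv h x + 1" for x
  proof -
    have "h (inv h x + 1) = x + 1" using shift dyadic_auto_f_inv[OF h] by simp
    then show ?thesis using dyadic_auto_inv_f[OF h] by metis
  qed
  then have "inv h \<circ> aff i d \<circ> inv (inv h) \<in> PL2" if "d \<in> Dy" for i d
    using conj_aff_PL2[OF hi _ _ that] dbl(2) hii by simp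
  then have "inv h \<circ> f \<circ> h \<in> PL2" if "f \<in> PL2" for f using conj_PL2I[OF hi _ that] hii by simp
  moreover have "h \<circ> f \<circ> inv h \<in> PL2" if "f \<in> PL2" for f
    using conj_PL2I[OF h conj_aff_PL2[OF h shift dbl(1)] that] .
  ultimately show ?thesis using h by (simp add: normaliser_def)
qed

lemma normaliser_dyadic_auto: "normaliser h \<Longrightarrow> dyadic_auto h"
  by (simp add: normaliser_def)

lemma normaliser_inv: "normaliser h \<Longrightarrow> normaliser (inv h)"
  by (simp add: normaliser_def dyadic_auto_inv dyadic_auto_inv_inv)

lemma normaliser_comp: assumes "normaliser g" "normaliser h" shows "normaliser (g \<circ> h)"
proof -
  have gh: "dyadic_auto g" "dyadic_auto h" using assms by (auto simp: normaliser_def)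
  have "g \<circ> (h \<circ> f \<circ> inv h) \<circ> inv g \<in> PL2" "inv h \<circ> (inv g \<circ> f \<circ> g) \<circ> h \<in> PL2" if "f \<in> PL2" for f
    using assms that unfolding normaliser_def by blast+
  then show ?thesis using gh by (simp add: normaliser_def dyadic_auto_comp dyadic_auto_inv_comp o_assoc)
qed

lemma PL2_normaliser: "f \<in> PL2 \<Longrightarrow> normaliser f"
  by (simp add: normaliser_def PL2_dyadic_auto PL2_comp PL2_inv)

text \<open>Conjugation by \<open>h\<close> and by \<open>inv h\<close> turns the germ of doubling at \<open>0\<close> into multiplication by
  \<open>2 powi b\<close> and \<open>2 powi c\<close>, and then \<open>b * c = 1\<close>.\<close>

lemma normaliser_double_near_0:
  assumes h: "normaliser h" "h 0 = 0"
  obtains \<delta> where "\<delta> > 0" "\<And>u. 0 \<le> u \<Longrightarrow> u \<le> \<delta> \<Longrightarrow> h (2 * u) = 2 * h u"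
proof -
  have ho: "dyadic_auto h" by (rule normaliser_dyadic_auto[OF h(1)])
  have inv0: "inv h 0 = 0" using dyadic_auto_inv_f[OF ho, of 0] h(2) by simp
  have S: "aff 1 0 \<in> PL2" by (rule aff_PL2) simp
  have less: "h x < h y \<longleftrightarrow> x < y" for x y by (rule dyadic_auto_less[OF ho])
  have le: "h x \<le> h y \<longleftrightarrow> x \<le> y" for x y by (rule dyadic_auto_le[OF ho])
  have pos: "0 < h x \<longleftrightarrow> 0 < x" for x using less[of 0 x] h(2) by simp
  have "pl_at (h \<circ> aff 1 0 \<circ> inv h) 0" "pl_at (inv h \<circ> aff 1 0 \<circ> h) 0"
    using h(1) S by (auto simp: normaliser_def intro: PL2_pl_at)
  then obtain e b e' c where e: "e > 0" "\<forall>t\<in>{0..e}. (h \<circ> aff 1 0 \<circ> inv h) (0 + t) = (h \<circ> aff 1 0 \<circ> inv h) 0 + 2 powi b * t"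
    and e': "e' > 0" "\<forall>t\<in>{0..e'}. (inv h \<circ> aff 1 0 \<circ> h) (0 + t) = (inv h \<circ> aff 1 0 \<circ> h) 0 + 2 powi c * t"
    unfolding pl_at_def by blast
  have hb: "h (2 * u) = 2 powi b * h u" if "0 \<le> h u" "h u \<le> e" for u
    using e(2)[rule_format, of "h u"] that by (simp add: aff_def dyadic_auto_inv_f[OF ho] inv0 h(2))
  have hc: "2 * h u = h (2 powi c * u)" if "0 \<le> u" "u \<le> e'" for u
  proof -
    have "inv h (2 * h u) = 2 powi c * u"
      using e'(2)[rule_format, of u] that by (simp add: aff_def inv0 h(2))
    then show ?thesis using dyadic_auto_f_inv[OF ho, of "2 * h u"] by simp
  qed
  have small: "\<exists>d>0. \<forall>u. u \<le> d \<longrightarrow> h u \<le> r" if "r > 0" for r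
  proof (intro exI[of _ "inv h r"] conjI allI impI)
    have "h 0 < h (inv h r)" using that h(2) by (simp add: dyadic_auto_f_inv[OF ho])
    then show "inv h r > 0" by (simp add: less)
    fix u assume "u \<le> inv h r"
    then have "h u \<le> h (inv h r)" by (simp add: le)
    then show "h u \<le> r" by (simp add: dyadic_auto_f_inv[OF ho])
  qed
  obtain d where d: "d > 0" "\<And>u. u \<le> d \<Longrightarrow> h u \<le> e" using small[OF e(1)] by blast
  \<comment> \<open>An increasing \<open>h\<close> has \<open>h d < h (2 * d)\<close>, so the factor
    \<open>2 powi b\<close> exceeds \<open>1\<close>; likewise for \<open>c\<close>.\<close>
  have "b > 0"
  proof (rule ccontr)
    assume "\<not> b > 0"
    then have "(2::real) powi b \<le> 2 powi 0" by (intro power_int_increasing) auto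
    moreover have "h (2 * d) = 2 powi b * h d" using d(2)[of d] d(1) pos[of d] by (intro hb) auto
    moreover have "h d < h (2 * d)" "0 < h d" using d(1) by (auto simp: less pos)
    ultimately show False by (simp add: mult_le_cancel_right1 not_less)
  qed
  have "c > 0"
  proof (rule ccontr)
    assume "\<not> c > 0"
    then have "(2::real) powi c \<le> 2 powi 0" by (intro power_int_increasing) auto
    then have "2 powi c * e' \<le> e'" using e'(1) by simp
    then have "h (2 powi c * e') \<le> h e'" by (simp only: le)
    then show False using hc[of e'] e'(1) pos[of e'] by simp
  qed
  define n where "n = nat c"
  have n: "c = int n" "n > 0" using \<open>c > 0\<close> by (auto simp: n_def)
  have iter: "h (2 ^ k * u) = 2 powi (b * int k) * h u" if "0 \<le> u" "2 ^ k * u \<le> d" for k u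
    using that(2)
  proof (induction k)
    case (Suc k)
    have "2 ^ k * u \<le> 2 ^ Suc k * u" using that(1) by simp
    then have ku: "2 ^ k * u \<le> d" using Suc.prems by linarith
    have "0 \<le> h (2 ^ k * u)" using le[of 0 "2 ^ k * u"] that(1) h(2) by simp
    then have "h (2 * (2 ^ k * u)) = 2 powi b * h (2 ^ k * u)" using d(2)[OF ku] by (rule hb)
    then have "h (2 ^ Suc k * u) = 2 powi b * (2 powi (b * int k) * h u)"
      using Suc.IH[OF ku] by (simp only: power_Suc mult.assoc)
    moreover have "(2::real) powi (b * int (Suc k)) = 2 powi b * 2 powi (b * int k)"
      by (simp add: distrib_left powi2_add)
    ultimately show ?case by (simp only: mult.assoc)
  qed simp
  \<comment> \<open>Small enough for \<open>hc\<close> to hold at \<open>u\<close> and for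
    \<open>c\<close> successive doublings of \<open>u\<close> to stay in the range of
    \<open>hb\<close>; comparing the two gives \<open>2 = 2 powi (b * c)\<close>.\<close>
  define u where "u = min e' (d / 2 ^ n)"
  have u: "0 < u" "u \<le> e'" "2 ^ n * u \<le> d"
    using e'(1) d(1) by (auto simp: u_def min_le_iff_disj pos_le_divide_eq[symmetric] mult.commute[of "2 ^ n"])
  have "2 * h u = 2 powi (b * c) * h u" using hc[of u] iter[of u n] u n(1) by simp
  moreover have "h u > 0" using u(1) by (simp add: pos)
  ultimately have "(2::real) powi (b * c) = 2 powi 1" by simp
  then have "b * c = 1" by (simp only: powi2_inj)
  then have "b = 1" using \<open>b > 0\<close> \<open>c > 0\<close> by (simp add: zmult_eq_1_iff)
  show ?thesis
  proof (rule that[OF d(1)])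
    fix u assume "0 \<le> u" "u \<le> d"
    then show "h (2 * u) = 2 * h u" using hb[of u] d(2)[of u] le[of 0 u] h(2) \<open>b = 1\<close> by simp
  qed
qed

text \<open>On a bounded interval \<open>\<phi>\<close> agrees with a normaliser \<open>P\<close>,
  so the conjugated translation agrees there with \<open>P \<circ> aff 0 q \<circ> inv P\<close>, an
  element of \<open>PL2\<close>.\<close>

lemma renorm_mapI:
  assumes mono: "\<And>x y. 0 \<le> x \<Longrightarrow> x < y \<Longrightarrow> \<phi> x < \<phi> y"
    and nonneg: "\<And>x. 0 \<le> x \<Longrightarrow> 0 \<le> \<phi> x" "\<And>y. 0 \<le> y \<Longrightarrow> 0 \<le> \<psi> y"
    and inv: "\<And>x. 0 \<le> x \<Longrightarrow> \<psi> (\<phi> x) = x" "\<And>y. 0 \<le> y \<Longrightarrow> \<phi> (\<psi> y) = y"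
    and double: "\<And>x. 0 \<le> x \<Longrightarrow> \<phi> (2 * x) = 2 * \<phi> x"
    and approx: "\<And>M. \<exists>P. normaliser P \<and> (\<forall>x. 0 \<le> x \<longrightarrow> x \<le> M \<longrightarrow> \<phi> x = P x)"
  shows "renorm_map \<phi> \<psi>"
proof
  fix x :: real assume x: "0 \<le> x"
  obtain P where P: "normaliser P" "\<forall>y. 0 \<le> y \<longrightarrow> y \<le> x \<longrightarrow> \<phi> y = P y" using approx by blast
  then show "\<phi> x \<in> Dy \<longleftrightarrow> x \<in> Dy" using x dyadic_auto_Dy[OF normaliser_dyadic_auto[OF P(1)]] by simp
next
  fix q x :: real assume q: "q \<in> Dy" "0 \<le> q" and x: "0 \<le> x"
  \<comment> \<open>The summand \<open>1\<close> leaves room to the right of \<open>x\<close>, and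
    \<open>q\<close> covers the translated points.\<close>
  obtain P where P: "normaliser P" "\<And>y. 0 \<le> y \<Longrightarrow> y \<le> x + 1 + q \<Longrightarrow> \<phi> y = P y" using approx by blast
  have Po: "dyadic_auto P" by (rule normaliser_dyadic_auto[OF P(1)])
  define F where "F = P \<circ> aff 0 q \<circ> inv P"
  have "F \<in> PL2" using P(1) aff_PL2[OF q(1)] by (simp add: F_def normaliser_def)
  then have "pl_at F (\<phi> x)" by (rule PL2_pl_at)
  then obtain e i j where e: "e > 0"
    "\<forall>t\<in>{0..e}. F (\<phi> x + t) = F (\<phi> x) + 2 powi i * t \<and> F (\<phi> x - t) = F (\<phi> x) - 2 powi j * t" "\<phi> x \<notin> Dy \<longrightarrow> i = j"
    unfolding pl_at_def by blast
  have F_eq: "\<phi> (\<psi> z + q) = F z" if "0 \<le> z" "z \<le> \<phi> (x + 1)" for z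
  proof -
    have "\<psi> z \<le> x + 1"
    proof (rule ccontr)
      assume "\<not> \<psi> z \<le> x + 1"
      then have "\<phi> (x + 1) < \<phi> (\<psi> z)" using x by (intro mono) auto
      then show False using inv(2)[OF that(1)] that(2) by simp
    qed
    moreover from this have "P (\<psi> z) = z" using P(2)[of "\<psi> z"] inv(2)[OF that(1)] nonneg(2)[OF that(1)] q by simp
    then have "inv P z = \<psi> z" using dyadic_auto_inv_f[OF Po, of "\<psi> z"] by simp
    ultimately show ?thesis using P(2)[of "\<psi> z + q"] nonneg(2)[OF that(1)] q by (simp add: F_def aff_def)
  qed
  have Fx: "F (\<phi> x) = \<phi> (x + q)"
    using F_eq[of "\<phi> x"] nonneg(1)[OF x] mono[of x "x + 1"] x inv(1)[OF x] by simp
  have step: "\<phi> x < \<phi> (x + 1)" using x by (intro mono) auto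
  \<comment> \<open>Within this radius \<open>\<phi> x + t\<close> stays below
    \<open>\<phi> (x + 1)\<close>, where \<open>F_eq\<close> applies, and
    \<open>\<phi> x - t\<close> stays nonnegative when \<open>x > 0\<close>. The value
    \<open>1\<close> is only a filler for \<open>x = 0\<close>.\<close>
  define e' where "e' = min e (min (\<phi> (x + 1) - \<phi> x) (if 0 < x then \<phi> x else 1))"
  have "0 < \<phi> x" if "0 < x" using mono[of 0 x] nonneg(1)[of 0] that by simp
  then have e': "e' > 0" "e' \<le> e" "e' \<le> \<phi> (x + 1) - \<phi> x" "0 < x \<Longrightarrow> e' \<le> \<phi> x"
    using e(1) step by (auto simp: e'_def)
  have xDy: "\<phi> x \<in> Dy \<longleftrightarrow> x \<in> Dy" using P(2)[of x] x q dyadic_auto_Dy[OF Po] by simp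
  show "\<exists>e>0. \<exists>i j :: int. (\<forall>t\<in>{0..e}. \<phi> (\<psi> (\<phi> x + t) + q) = \<phi> (x + q) + 2 powi i * t) \<and>
      (0 < x \<longrightarrow> e \<le> \<phi> x \<and> (\<forall>t\<in>{0..e}. \<phi> (\<psi> (\<phi> x - t) + q) = \<phi> (x + q) - 2 powi j * t) \<and>
        (x \<notin> Dy \<longrightarrow> i = j))"
  proof (rule exI[of _ e'], rule conjI[OF e'(1)], rule exI[of _ i], rule exI[of _ j], intro conjI impI ballI)
    fix t assume t: "t \<in> {0..e'}"
    then have "\<phi> (\<psi> (\<phi> x + t) + q) = F (\<phi> x + t)"
      using e'(3) nonneg(1)[OF x] by (intro F_eq) auto
    also have "\<dots> = \<phi> (x + q) + 2 powi i * t" using e(2) t e'(2) Fx by auto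
    finally show "\<phi> (\<psi> (\<phi> x + t) + q) = \<phi> (x + q) + 2 powi i * t" .
  next
    fix t assume x0: "0 < x" and t: "t \<in> {0..e'}"
    then have "\<phi> (\<psi> (\<phi> x - t) + q) = F (\<phi> x - t)"
      using e'(4) step by (intro F_eq) auto
    also have "\<dots> = \<phi> (x + q) - 2 powi j * t" using e(2) t e'(2) Fx by auto
    finally show "\<phi> (\<psi> (\<phi> x - t) + q) = \<phi> (x + q) - 2 powi j * t" .
  qed (use e e' xDy in auto)
qed (use assms in auto)

text \<open>The maps \<open>P n x = 2 ^ n * h (x / 2 ^ n)\<close> stabilise on
  \<open>[0, 2 ^ n * \<delta>]\<close> because \<open>h\<close> commutes with doubling on
  \<open>[0, \<delta>]\<close>. Their common extension \<open>\<phi>\<close> commutes with doubling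
  on the half line and equals a normaliser on each bounded interval, and so does its
  inverse.\<close>

lemma normaliser_linear_near_0:
  assumes h: "normaliser h" "h 0 = 0"
  obtains \<delta> c where "\<delta> > 0" "c > 0" "\<And>u. 0 \<le> u \<Longrightarrow> u \<le> \<delta> \<Longrightarrow> h u = c * u"
proof -
  have ho: "dyadic_auto h" by (rule normaliser_dyadic_auto[OF h(1)])
  obtain \<delta> where \<delta>: "\<delta> > 0" "\<And>u. 0 \<le> u \<Longrightarrow> u \<le> \<delta> \<Longrightarrow> h (2 * u) = 2 * h u"
    by (rule normaliser_double_near_0[OF h]) blast
  define P where "P n = aff (int n) 0 \<circ> h \<circ> aff (- int n) 0" for n
  have P_eq: "P n x = 2 ^ n * h (x / 2 ^ n)" for n x
    by (simp add: P_def aff_def power_int_minus field_simps)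
  have Pn: "normaliser (P n)" for n
    unfolding P_def by (intro normaliser_comp h PL2_normaliser aff_PL2 Dy_0)
  have P_Suc: "P (Suc n) x = P n x" if "0 \<le> x" "x \<le> 2 ^ n * \<delta>" for n x
  proof -
    have "h (2 * (x / 2 ^ Suc n)) = 2 * h (x / 2 ^ Suc n)"
      using that \<delta>(1) by (intro \<delta>(2)) (auto simp: pos_divide_le_eq mult.commute)
    then show ?thesis by (simp add: P_eq)
  qed
  have grow: "2 ^ m * \<delta> \<le> 2 ^ n * \<delta>" if "m \<le> n" for m n :: nat
    using that \<delta>(1) by (intro mult_right_mono power_increasing) auto
  have P_stable: "P n x = P m x" if "0 \<le> x" "x \<le> 2 ^ m * \<delta>" "m \<le> n" for m n x
    using that(3)
  proof (induction n rule: dec_induct)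
    case (step n)
    have "x \<le> 2 ^ n * \<delta>" using that(2) grow[OF step(1)] by linarith
    then show ?case using P_Suc[OF that(1)] step by simp
  qed simp
  have ex: "\<exists>n. x \<le> 2 ^ n * \<delta>" for x
  proof -
    obtain n where "x / \<delta> < 2 ^ n" using real_arch_pow[of 2 "x / \<delta>"] by auto
    then have "x \<le> 2 ^ n * \<delta>" using \<delta>(1) by (simp add: pos_divide_less_eq)
    then show ?thesis ..
  qed
  \<comment> \<open>Every \<open>n\<close> with \<open>x \<le> 2 ^ n * \<delta>\<close> gives the
    same value; \<open>LEAST\<close> merely selects one.\<close>
  define \<phi> where "\<phi> x = P (LEAST n. x \<le> 2 ^ n * \<delta>) x" for x
  have \<phi>_eq: "\<phi> x = P n x" if "0 \<le> x" "x \<le> 2 ^ n * \<delta>" for n x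
    unfolding \<phi>_def
    by (rule P_stable[symmetric, OF that(1)]) (rule LeastI[of _ n], rule that(2), rule Least_le, rule that(2))
  have approx: "\<exists>Q. normaliser Q \<and> (\<forall>x. 0 \<le> x \<longrightarrow> x \<le> M \<longrightarrow> \<phi> x = Q x)" for M
  proof -
    obtain n where "M \<le> 2 ^ n * \<delta>" using ex by blast
    then show ?thesis using Pn[of n] \<phi>_eq by (intro exI[of _ "P n"]) auto
  qed
  have mono: "\<phi> x < \<phi> y" if "0 \<le> x" "x < y" for x y
  proof -
    obtain n where n: "y \<le> 2 ^ n * \<delta>" using ex by blast
    then show ?thesis using \<phi>_eq[of x n] \<phi>_eq[of y n] that dyadic_auto_less[OF normaliser_dyadic_auto[OF Pn[of n]]] by simp
  qed
  have zero: "\<phi> 0 = 0" using \<phi>_eq[of 0 0] \<delta>(1) h(2) by (simp add: P_eq)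
  have nonneg: "0 \<le> \<phi> x" if "0 \<le> x" for x using mono[of 0 x] zero that by (cases "x = 0") auto
  have surj: "\<exists>x\<ge>0. \<phi> x = y" if "0 \<le> y" for y
  proof -
    have "h 0 < h \<delta>" using \<delta>(1) by (simp add: dyadic_auto_less[OF ho])
    then have h\<delta>: "h \<delta> > 0" using h(2) by simp
    obtain n where "y / h \<delta> < 2 ^ n" using real_arch_pow[of 2 "y / h \<delta>"] by auto
    then have n: "y / 2 ^ n \<le> h \<delta>" using h\<delta> by (simp add: pos_divide_less_eq pos_divide_le_eq mult.commute)
    define u where "u = inv h (y / 2 ^ n)"
    have hu: "h u = y / 2 ^ n" by (simp add: u_def dyadic_auto_f_inv[OF ho])
    have "h 0 \<le> h u" "h u \<le> h \<delta>" using hu h(2) that n by auto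
    then have u: "0 \<le> u" "u \<le> \<delta>" by (auto simp: dyadic_auto_le[OF ho])
    have "\<phi> (2 ^ n * u) = y" using \<phi>_eq[of "2 ^ n * u" n] u by (simp add: P_eq hu)
    then show ?thesis using u(1) by (intro exI[of _ "2 ^ n * u"]) simp
  qed
  define \<psi> where "\<psi> y = (SOME x. 0 \<le> x \<and> \<phi> x = y)" for y
  have \<psi>: "0 \<le> \<psi> y" "\<phi> (\<psi> y) = y" if "0 \<le> y" for y
  proof -
    have "0 \<le> \<psi> y \<and> \<phi> (\<psi> y) = y" unfolding \<psi>_def by (rule someI_ex) (use surj[OF that] in blast)
    then show "0 \<le> \<psi> y" "\<phi> (\<psi> y) = y" by auto
  qed
  have \<psi>\<phi>: "\<psi> (\<phi> x) = x" if "0 \<le> x" for x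
    using \<psi>[OF nonneg[OF that]] mono[of x "\<psi> (\<phi> x)"] mono[of "\<psi> (\<phi> x)" x] that
    by (cases x "\<psi> (\<phi> x)" rule: linorder_cases) auto
  have double: "\<phi> (2 * x) = 2 * \<phi> x" if "0 \<le> x" for x
  proof -
    obtain n where n: "x \<le> 2 ^ n * \<delta>" using ex by blast
    then have "\<phi> (2 * x) = P (Suc n) (2 * x)" using that by (intro \<phi>_eq) auto
    also have "\<dots> = 2 * P n x" by (simp add: P_eq)
    also have "P n x = \<phi> x" using \<phi>_eq[OF that n] by simp
    finally show ?thesis .
  qed
  have \<psi>_mono: "\<psi> x < \<psi> y" if "0 \<le> x" "x < y" for x y
  proof (rule ccontr)
    assume "\<not> \<psi> x < \<psi> y"
    then have "\<phi> (\<psi> y) \<le> \<phi> (\<psi> x)" using mono[of "\<psi> y" "\<psi> x"] \<psi>(1)[of y] that by (cases "\<psi> y = \<psi> x") auto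
    then show False using \<psi>(2) that by simp
  qed
  have \<psi>_double: "\<psi> (2 * y) = 2 * \<psi> y" if "0 \<le> y" for y
    using \<psi>\<phi>[of "2 * \<psi> y"] double[of "\<psi> y"] \<psi>[OF that] by simp
  have "renorm_map \<phi> \<psi>"
    by (rule renorm_mapI) (use mono nonneg \<psi> \<psi>\<phi> double approx in auto)
  moreover have "renorm_map \<psi> \<phi>"
  proof (rule renorm_mapI)
    fix M
    obtain Q where Q: "normaliser Q" "\<And>x. 0 \<le> x \<Longrightarrow> x \<le> \<psi> M \<Longrightarrow> \<phi> x = Q x" using approx by blast
    have "\<psi> y = inv Q y" if "0 \<le> y" "y \<le> M" for y
    proof -
      have "\<psi> y \<le> \<psi> M" using \<psi>_mono[of y M] that by (cases "y = M") auto
      then have "Q (\<psi> y) = y" using Q(2)[of "\<psi> y"] \<psi>[OF that(1)] by simp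
      then show ?thesis using dyadic_auto_inv_f[OF normaliser_dyadic_auto[OF Q(1)], of "\<psi> y"] by simp
    qed
    then show "\<exists>P. normaliser P \<and> (\<forall>x. 0 \<le> x \<longrightarrow> x \<le> M \<longrightarrow> \<psi> x = P x)"
      using normaliser_inv[OF Q(1)] by blast
  qed (use \<psi>_mono nonneg \<psi> \<psi>\<phi> \<psi>_double in auto)
  ultimately obtain c where c: "c > 0" "\<And>x. 0 \<le> x \<Longrightarrow> \<phi> x = c * x"
    by (rule renorm_map_linear) blast
  show ?thesis
  proof (rule that[OF \<delta>(1) c(1)])
    fix u assume "0 \<le> u" "u \<le> \<delta>"
    then show "h u = c * u" using c(2)[of u] \<phi>_eq[of u 0] by (simp add: P_eq)
  qed
qed

text \<open>Subtracting the dyadic number \<open>h 0\<close> yields a normaliser \<open>g\<close>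
  that is linear to the right of \<open>0\<close>. Near \<open>x > 0\<close> one has
  \<open>g s = F (c * (s / 2 ^ n))\<close> with \<open>F\<close> the conjugate by \<open>g\<close>
  of multiplication by \<open>2 ^ n\<close>, an element of \<open>PL2\<close>. Integer translations
  reach the remaining points.\<close>

lemma periodic_normaliser_locally_affine:
  assumes h: "dyadic_auto h" and shift: "\<And>x. h (x + 1) = h x + 1"
    and dbl: "h \<circ> aff 1 0 \<circ> inv h \<in> PL2" "inv h \<circ> aff 1 0 \<circ> h \<in> PL2"
  shows "\<exists>e>0. \<exists>a b. \<forall>t\<in>{0..e}. h (x + t) = h x + a * t \<and> h (x - t) = h x - b * t"
proof -
  define p where "p = h 0"
  define g where "g = aff 0 (- p) \<circ> h"
  have g_eq: "g x = h x - p" for x by (simp add: g_def aff_def)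
  have "p \<in> Dy" using dyadic_auto_Dy[OF h, of 0] by (simp add: p_def)
  then have "normaliser g" unfolding g_def
    by (intro normaliser_comp normaliserI[OF h shift dbl] PL2_normaliser aff_PL2 Dy_uminus)
  moreover have "g 0 = 0" by (simp add: g_eq p_def)
  ultimately obtain \<delta> c where \<delta>: "\<delta> > 0" "c > 0" "\<And>u. 0 \<le> u \<Longrightarrow> u \<le> \<delta> \<Longrightarrow> g u = c * u"
    by (rule normaliser_linear_near_0) blast
  have go: "dyadic_auto g" by (rule normaliser_dyadic_auto) fact
  have pos: "\<exists>e>0. \<exists>a b. \<forall>t\<in>{0..e}. g (x + t) = g x + a * t \<and> g (x - t) = g x - b * t" if "x > 0" for x
  proof -
    obtain n where "x / \<delta> < 2 ^ n" using real_arch_pow[of 2 "x / \<delta>"] by auto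
    then have n: "x / 2 ^ n < \<delta>" using \<delta>(1) by (simp add: pos_divide_less_eq mult.commute)
    define F where "F = g \<circ> aff (int n) 0 \<circ> inv g"
    have "F \<in> PL2" using \<open>normaliser g\<close> aff_PL2[OF Dy_0] by (simp add: F_def normaliser_def)
    define z where "z = c * (x / 2 ^ n)"
    have "pl_at F z" by (rule PL2_pl_at) fact
    then obtain e i j where e: "e > 0"
      "\<forall>t\<in>{0..e}. F (z + t) = F z + 2 powi i * t \<and> F (z - t) = F z - 2 powi j * t"
      unfolding pl_at_def by blast
    have gF: "g s = F (c * (s / 2 ^ n))" if "0 \<le> s" "s / 2 ^ n \<le> \<delta>" for s
    proof -
      have "g (s / 2 ^ n) = c * (s / 2 ^ n)" using that by (intro \<delta>(3)) auto
      then have "inv g (c * (s / 2 ^ n)) = s / 2 ^ n" using dyadic_auto_inv_f[OF go, of "s / 2 ^ n"] by simp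
      then show ?thesis by (simp add: F_def aff_def)
    qed
    define e' where "e' = min x (min (2 ^ n * (\<delta> - x / 2 ^ n)) (e * 2 ^ n / c))"
    have e': "e' > 0" "e' \<le> x" "e' \<le> 2 ^ n * (\<delta> - x / 2 ^ n)" "e' \<le> e * 2 ^ n / c"
      using that n e(1) \<delta>(2) by (auto simp: e'_def)
    show ?thesis
    proof (rule exI[of _ e'], rule conjI[OF e'(1)], rule exI[of _ "2 powi i * c / 2 ^ n"],
        rule exI[of _ "2 powi j * c / 2 ^ n"], intro conjI ballI)
      fix t assume t: "t \<in> {0..e'}"
      define s where "s = c * (t / 2 ^ n)"
      have "t \<le> e * 2 ^ n / c" using t e'(4) by simp
      then have s: "s \<in> {0..e}" using t \<delta>(2) by (simp add: s_def pos_le_divide_eq pos_divide_le_eq mult.commute)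
      have tb: "t / 2 ^ n \<le> \<delta> - x / 2 ^ n" using t e'(3) by (simp add: pos_divide_le_eq mult.commute)
      have xt: "c * ((x + t) / 2 ^ n) = z + s" "c * ((x - t) / 2 ^ n) = z - s"
        by (simp_all add: z_def s_def add_divide_distrib diff_divide_distrib distrib_left right_diff_distrib)
      have gx: "g x = F z" using gF[of x] that n by (simp add: z_def)
      have "g (x + t) = F (z + s)"
        using gF[of "x + t"] that t tb xt(1) by (simp add: add_divide_distrib)
      then show "g (x + t) = g x + 2 powi i * c / 2 ^ n * t" using e(2) s gx by (simp add: s_def)
      have "(x - t) / 2 ^ n \<le> x / 2 ^ n" using t by (intro divide_right_mono) auto
      then have "g (x - t) = F (z - s)" using gF[of "x - t"] t e'(2) n xt(2) by simp
      then show "g (x - t) = g x - 2 powi j * c / 2 ^ n * t" using e(2) s gx by (simp add: s_def)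
    qed
  qed
  have shift_nat: "h (x + real k) = h x + real k" for x k
    by (induction k) (use shift in \<open>simp_all add: add.assoc[symmetric] add.commute[of 1]\<close>)
  obtain k where k: "- x < real k" using reals_Archimedean2 by blast
  then have "x + real k > 0" by simp
  from pos[OF this] obtain e a b where e: "e > 0"
    "\<forall>t\<in>{0..e}. g (x + real k + t) = g (x + real k) + a * t \<and> g (x + real k - t) = g (x + real k) - b * t" by blast
  have "h (x + t) = h x + a * t \<and> h (x - t) = h x - b * t" if "t \<in> {0..e}" for t
  proof -
    have "g (x + real k + t) = g (x + real k) + a * t" "g (x + real k - t) = g (x + real k) - b * t"
      using e(2) that by auto
    moreover have "x + real k + t = (x + t) + real k" "x + real k - t = (x - t) + real k" by simp_all
    ultimately show ?thesis unfolding g_eq by (simp only: shift_nat) simp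
  qed
  then show ?thesis using e(1) by blast
qed

subsection \<open>Lifts of circle maps\<close>

lemma to_circle_eq_iff: "to_circle a = to_circle b \<longleftrightarrow> a - b \<in> \<int>"
  by transfer simp

lemma to_circle_add_of_int: "to_circle (a + of_int k) = to_circle a"
  by (simp add: to_circle_eq_iff)

lemma to_circle_surj: obtains t where "x = to_circle t"
proof -
  have "\<exists>t. x = to_circle t"
  proof transfer
    fix x :: real
    show "\<exists>t. x - t \<in> \<int>" by (rule exI[of _ x]) simp
  qed
  then show ?thesis using that by blast
qed

lemma nu2_to_circle: "nu2 (to_circle t) = to_circle (2 * t)"
  by transfer simp

lemma to_circle_in_dyadic_iff: "to_circle t \<in> dyadic \<longleftrightarrow> t \<in> Dy"
proof
  assume "to_circle t \<in> dyadic"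
  then obtain a b :: int where "to_circle t = to_circle (of_int a * 2 powi b)"
    by (auto simp: dyadic_def)
  then obtain k where k: "t - of_int a * 2 powi b = of_int k"
    by (auto simp: to_circle_eq_iff elim: Ints_cases)
  have "of_int a * 2 powi b \<in> Dy" unfolding Dy_def by blast
  then have "of_int a * 2 powi b + of_int k \<in> Dy" by (rule Dy_add) simp
  then show "t \<in> Dy" using k by (simp add: algebra_simps)
qed (auto simp: dyadic_def Dy_def)

lemma continuous_on_to_circle: "continuous_on A to_circle"
proof -
  have "continuous_on UNIV to_circle"
    by (rule continuous_on_open_vimage[THEN iffD2, rule_format]) (auto simp: open_circle_def)
  then show ?thesis by (rule continuous_on_subset) simp
qed

lemma open_to_circle_image: assumes "open W" shows "open (to_circle ` W)"
proof -
  have "to_circle -` (to_circle ` W) = (\<Union>k::int. (\<lambda>t. of_int k + t) ` W)"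
  proof (intro set_eqI iffI)
    fix t assume "t \<in> to_circle -` (to_circle ` W)"
    then obtain s where "s \<in> W" "to_circle t = to_circle s" by auto
    then obtain k where "t - s = of_int k" by (auto simp: to_circle_eq_iff elim: Ints_cases)
    then have "t = of_int k + s" by simp
    then show "t \<in> (\<Union>k::int. (\<lambda>t. of_int k + t) ` W)" using \<open>s \<in> W\<close> by blast
  next
    fix t assume "t \<in> (\<Union>k::int. (\<lambda>t. of_int k + t) ` W)"
    then obtain k s where ks: "s \<in> W" "t = of_int k + s" by auto
    then have "to_circle t = to_circle s" using to_circle_add_of_int[of s k] by (simp add: add.commute)
    then show "t \<in> to_circle -` (to_circle ` W)" using ks by auto
  qed
  moreover have "open (\<Union>k::int. (\<lambda>t. of_int k + t) ` W)"
    using assms by (intro open_UN ballI open_translation)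
  ultimately show ?thesis by (simp add: open_circle_def)
qed

lemma eventually_nhds_to_circle:
  "(\<forall>\<^sub>F y in nhds (to_circle t). P y) \<longleftrightarrow> (\<forall>\<^sub>F s in nhds t. P (to_circle s))"
proof
  assume "\<forall>\<^sub>F y in nhds (to_circle t). P y"
  then obtain U where "open U" "to_circle t \<in> U" "\<And>y. y \<in> U \<Longrightarrow> P y" by (auto simp: eventually_nhds)
  then show "\<forall>\<^sub>F s in nhds t. P (to_circle s)"
    unfolding eventually_nhds by (intro exI[of _ "to_circle -` U"]) (auto simp: open_circle_def)
next
  assume "\<forall>\<^sub>F s in nhds t. P (to_circle s)"
  then obtain W where "open W" "t \<in> W" "\<And>s. s \<in> W \<Longrightarrow> P (to_circle s)" by (auto simp: eventually_nhds)
  then show "\<forall>\<^sub>F y in nhds (to_circle t). P y"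
    unfolding eventually_nhds by (intro exI[of _ "to_circle ` W"]) (auto intro: open_to_circle_image)
qed

text \<open>An injection of the quotient into the complex plane, through which lifts become
  continuous logarithms.\<close>

lift_definition circle_cis :: "circle \<Rightarrow> complex" is "\<lambda>t. cis (2 * pi * t)"
proof -
  fix x y :: real assume "x - y \<in> \<int>"
  then obtain k :: int where "x = y + of_int k" by (auto elim!: Ints_cases simp: algebra_simps)
  then have "2 * pi * x = 2 * pi * y + 2 * pi * of_int k" by (simp add: algebra_simps)
  then show "cis (2 * pi * x) = cis (2 * pi * y)"
    by (simp add: cis_multiple_2pi flip: cis_mult)
qed

lemma circle_cis_to_circle: "circle_cis (to_circle t) = cis (2 * pi * t)"
  by transfer simp

lemma circle_cis_inject: assumes "circle_cis x = circle_cis y" shows "x = y"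
proof -
  obtain s where s: "x = to_circle s" by (rule to_circle_surj)
  obtain t where t: "y = to_circle t" by (rule to_circle_surj)
  then have "sin (2 * pi * s) = sin (2 * pi * t) \<and> cos (2 * pi * s) = cos (2 * pi * t)"
    using assms by (simp add: s t circle_cis_to_circle complex_eq_iff)
  then obtain n :: int where "2 * pi * s = 2 * pi * t + 2 * pi * of_int n"
    by (subst (asm) sin_cos_eq_iff) blast
  then have "2 * pi * s = 2 * pi * (t + of_int n)" by (simp add: distrib_left)
  then have "s = t + of_int n" by simp
  then show ?thesis using s t to_circle_add_of_int by simp
qed

lemma continuous_on_circle_cis: "continuous_on UNIV circle_cis"
proof (rule continuous_on_open_vimage[THEN iffD2, rule_format])
  fix B :: "complex set" assume "open B"
  then have "open ((\<lambda>t. cis (2 * pi * t)) -` B)"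
    by (rule open_vimage) (intro continuous_intros)
  moreover have "to_circle -` (circle_cis -` B) = (\<lambda>t. cis (2 * pi * t)) -` B"
    by (auto simp: circle_cis_to_circle)
  ultimately show "open (circle_cis -` B \<inter> UNIV)" by (simp add: open_circle_def)
qed simp

text \<open>The line is contractible, so the nowhere vanishing function
  \<open>circle_cis (h (to_circle t))\<close> has a continuous logarithm. Its values have modulus
  \<open>1\<close>, so the imaginary part alone gives the lift.\<close>

lemma continuous_lift:
  assumes "continuous_on UNIV h"
  obtains H :: "real \<Rightarrow> real" where "continuous_on UNIV H" "\<And>t. h (to_circle t) = to_circle (H t)"
proof -
  have unit: "norm (circle_cis x) = 1" for x
    by (rule to_circle_surj[of x]) (simp add: circle_cis_to_circle)
  have "continuous_on UNIV (\<lambda>t. h (to_circle t))"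
    by (rule continuous_on_compose2[OF assms continuous_on_to_circle]) simp
  then have "continuous_on UNIV (\<lambda>t. circle_cis (h (to_circle t)))"
    by (rule continuous_on_compose2[OF continuous_on_circle_cis]) simp
  moreover have "contractible (UNIV :: real set)" by (rule convex_imp_contractible) simp
  moreover have "circle_cis (h (to_circle t)) \<noteq> 0" for t using unit[of "h (to_circle t)"] by auto
  ultimately obtain g where g: "continuous_on UNIV g" "\<And>t. t \<in> UNIV \<Longrightarrow> circle_cis (h (to_circle t)) = exp (g t)"
    by (rule continuous_logarithm_on_contractible) blast
  show ?thesis
  proof (rule that[of "\<lambda>t. Im (g t) / (2 * pi)"])
    show "continuous_on UNIV (\<lambda>t. Im (g t) / (2 * pi))" using g(1) by (intro continuous_intros) auto
    fix t
    have "exp (Re (g t)) = 1" using unit[of "h (to_circle t)"] g(2)[of t] by simp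
    then have "exp (g t) = cis (Im (g t))" by (simp add: exp_eq_polar)
    then have "circle_cis (h (to_circle t)) = circle_cis (to_circle (Im (g t) / (2 * pi)))"
      by (simp add: circle_cis_to_circle g(2))
    then show "h (to_circle t) = to_circle (Im (g t) / (2 * pi))" by (rule circle_cis_inject)
  qed
qed

text \<open>The difference is integer valued near \<open>t\<close> and continuous at
  \<open>t\<close>, so it is constant as soon as it varies by less than \<open>1\<close>.\<close>

lemma lifts_differ_by_constant:
  assumes "isCont F t" "isCont G t" "\<forall>\<^sub>F s in nhds t. to_circle (F s) = to_circle (G s)"
  shows "\<forall>\<^sub>F s in nhds t. F s = G s + (F t - G t)"
proof -
  define d where "d s = F s - G s" for s
  have "isCont d t" unfolding d_def using assms by (intro continuous_intros)
  then have "\<forall>\<^sub>F s in nhds t. dist (d s) (d t) < 1"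
    by (intro tendstoD) (auto simp: isCont_def tendsto_at_iff_tendsto_nhds)
  moreover have "\<forall>\<^sub>F s in nhds t. d s \<in> \<int>" using assms(3) by (simp add: to_circle_eq_iff d_def)
  ultimately show ?thesis
  proof eventually_elim
    case (elim s)
    have "d t \<in> \<int>" using eventually_nhds_x_imp_x[OF assms(3)] by (simp add: to_circle_eq_iff d_def)
    then have "d s - d t \<in> \<int>" using elim by (intro Ints_diff)
    then have "d s = d t" using elim Ints_eq_abs_less1[of "d s" "d t"] \<open>d t \<in> \<int>\<close> by (simp add: dist_real_def)
    then show ?case by (simp add: d_def)
  qed
qed

text \<open>A maximum over \<open>{a..b}\<close> can be attained only at \<open>b\<close>, because
  just to the right of any other point \<open>H\<close> is larger.\<close>

lemma locally_increasing_imp_strict_mono: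
  fixes H :: "real \<Rightarrow> real"
  assumes cont: "continuous_on UNIV H" and loc: "\<And>t. \<exists>e>0. \<forall>s. t < s \<and> s < t + e \<longrightarrow> H t < H s"
  shows "strict_mono H"
proof (rule strict_monoI)
  fix a b :: real assume "a < b"
  have max_at_b: "m = b" if "m \<in> {a..b}" "\<And>x. x \<in> {a..b} \<Longrightarrow> H x \<le> H m" for m
  proof (rule ccontr)
    assume "m \<noteq> b"
    then have "m < b" using that(1) by simp
    obtain e where e: "e > 0" "\<And>s. m < s \<Longrightarrow> s < m + e \<Longrightarrow> H m < H s" using loc[of m] by blast
    define s where "s = min b (m + e / 2)"
    have "m < s" "s < m + e" "s \<in> {a..b}" using e(1) \<open>m < b\<close> that(1) by (auto simp: s_def min_def)
    then show False using e(2) that(2) by fastforce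
  qed
  have "continuous_on {a..b} H" using cont by (rule continuous_on_subset) simp
  then obtain m where m: "m \<in> {a..b}" "\<forall>x\<in>{a..b}. H x \<le> H m"
    using continuous_attains_sup[of "{a..b}" H] \<open>a < b\<close> by auto
  then have "m = b" using max_at_b by blast
  have "H a \<noteq> H b"
  proof
    assume "H a = H b"
    then have "a = b" using m \<open>m = b\<close> \<open>a < b\<close> by (intro max_at_b) auto
    then show False using \<open>a < b\<close> by simp
  qed
  moreover have "H a \<le> H b" using m \<open>m = b\<close> \<open>a < b\<close> by auto
  ultimately show "H a < H b" by simp
qed

lemma dyadic_auto_isCont: assumes "dyadic_auto f" shows "isCont f x"
proof -
  have "range f = UNIV" using assms by (simp add: dyadic_auto_def)
  then have "continuous_on UNIV f"
    by (intro continuous_onI_mono) (simp_all add: dyadic_auto_le[OF assms])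
  then show ?thesis by (simp add: continuous_on_eq_continuous_at)
qed

lemma homeomorphism_lift:
  assumes hom: "homeomorphism UNIV UNIV h (inv h)" and ori: "orientation_preserving_on UNIV h"
    and dy: "h ` dyadic = dyadic"
  obtains H where "dyadic_auto H" "\<And>t. h (to_circle t) = to_circle (H t)" "\<And>t. H (t + 1) = H t + 1"
proof -
  have cont: "continuous_on UNIV h" and bij: "bij h"
    using hom by (auto simp: homeomorphism_def bij_def intro: inj_on_inverseI[of _ "inv h"])
  obtain H where H: "continuous_on UNIV H" "\<And>t. h (to_circle t) = to_circle (H t)"
    using continuous_lift[OF cont] by blast
  have cH: "isCont H t" for t using H(1) by (simp add: continuous_on_eq_continuous_at)
  have "\<exists>e>0. \<forall>s. t < s \<and> s < t + e \<longrightarrow> H t < H s" for t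
  proof -
    obtain e F where e: "e > 0" and F: "continuous_on {t - e<..<t + e} F" "strict_mono_on {t - e<..<t + e} F"
      "\<forall>s\<in>{t - e<..<t + e}. h (to_circle s) = to_circle (F s)"
      using ori unfolding orientation_preserving_on_def by (meson UNIV_I)
    have "isCont F t" using F(1) e by (auto simp: continuous_on_eq_continuous_at)
    moreover have "\<forall>\<^sub>F s in nhds t. s \<in> {t - e<..<t + e}"
      using e by (intro eventually_nhds_in_open) auto
    then have "\<forall>\<^sub>F s in nhds t. to_circle (H s) = to_circle (F s)"
      by eventually_elim (use F(3) H(2) in auto)
    ultimately have "\<forall>\<^sub>F s in nhds t. H s = F s + (H t - F t)"
      using cH by (intro lifts_differ_by_constant)
    then obtain d where d: "d > 0" "\<And>s. dist s t < d \<Longrightarrow> H s = F s + (H t - F t)"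
      unfolding eventually_nhds_metric by blast
    show ?thesis
    proof (intro exI[of _ "min d e"] conjI allI impI)
      fix s assume s: "t < s \<and> s < t + min d e"
      then have "F t < F s" using e F(2) by (auto intro!: strict_mono_onD[OF F(2)])
      moreover have "dist s t < d" using s by (auto simp: dist_real_def)
      ultimately show "H t < H s" using d(2)[of s] by simp
    qed (use d e in auto)
  qed
  then have mono: "strict_mono H" by (rule locally_increasing_imp_strict_mono[OF H(1)])
  \<comment> \<open>The degree of \<open>h\<close>, at this stage possibly dependent on
    \<open>t\<close>.\<close>
  define n where "n t = H (t + 1) - H t" for t
  have n_Ints: "n t \<in> \<int>" for t
    using H(2)[of "t + 1"] H(2)[of t] to_circle_add_of_int[of t 1] by (simp add: n_def flip: to_circle_eq_iff)
  have period: "H (t + 1) = H t + 1" for t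
  proof -
    have "n t > 0" using mono by (simp add: n_def strict_mono_less)
    then have "n t \<ge> 1" using n_Ints[of t] by (auto elim!: Ints_cases)
    \<comment> \<open>A degree above \<open>1\<close> would make \<open>H\<close> take the value
      \<open>H t + 1\<close> strictly between \<open>t\<close> and \<open>t + 1\<close>, against
      injectivity of \<open>h\<close>.\<close>
    moreover have "\<not> n t > 1"
    proof
      assume "n t > 1"
      have "continuous_on {t..t + 1} H" using H(1) by (rule continuous_on_subset) simp
      then obtain s where s: "t \<le> s" "s \<le> t + 1" "H s = H t + 1"
        using IVT'[of H t "H t + 1" "t + 1"] \<open>n t > 1\<close> by (auto simp: n_def)
      then have "h (to_circle s) = h (to_circle t)" using H(2) to_circle_add_of_int[of "H t" 1] by simp
      then have "to_circle s = to_circle t" using bij by (simp add: bij_def inj_eq)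
      then have "s - t \<in> \<int>" by (simp add: to_circle_eq_iff)
      then obtain k :: int where k: "s - t = of_int k" by (rule Ints_cases)
      have "0 \<le> k" "k \<le> 1" using s k by auto
      then consider "s = t" | "s = t + 1" using k by (cases "k = 0") (auto simp: algebra_simps)
      then show False using s(3) \<open>n t > 1\<close> by cases (auto simp: n_def)
    qed
    ultimately show ?thesis by (simp add: n_def)
  qed
  have shift_nat: "H (t + real k) = H t + real k" for t k
    by (induction k) (use period in \<open>simp_all add: add.assoc[symmetric] add.commute[of 1]\<close>)
  have surj: "surj H"
    unfolding surj_def
  proof
    fix y
    obtain k where k: "\<bar>y - H 0\<bar> < real k" using reals_Archimedean2 by blast
    have "H (- real k) \<le> y" using shift_nat[of "- real k" k] k by simp
    moreover have "y \<le> H (real k)" using shift_nat[of 0 k] k by simp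
    ultimately obtain x where "H x = y"
      using IVT'[of H "- real k" y "real k"] continuous_on_subset[OF H(1)] by auto
    then show "\<exists>x. y = H x" by blast
  qed
  have "H x \<in> Dy \<longleftrightarrow> x \<in> Dy" for x
  proof -
    have "h (to_circle x) \<in> h ` dyadic \<longleftrightarrow> to_circle x \<in> dyadic" using bij by (simp add: bij_def inj_image_mem_iff)
    then show ?thesis using H(2)[of x] dy by (simp add: to_circle_in_dyadic_iff)
  qed
  then show ?thesis using that[of H] mono surj H(2) period by (simp add: dyadic_auto_def)
qed

section \<open>Translation between the local notions on the circle and germs of lifts\<close>

lemma eventually_nhds_shift:
  fixes t c :: real
  assumes "\<forall>\<^sub>F r in nhds t. P r" shows "\<forall>\<^sub>F r in nhds (t + c). P (r - c)"
proof -
  obtain d where d: "d > 0" "\<And>r. dist r t < d \<Longrightarrow> P r" using assms unfolding eventually_nhds_metric by blast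
  have "dist (r - c) t = dist r (t + c)" for r by (simp add: dist_real_def algebra_simps)
  then show ?thesis using d unfolding eventually_nhds_metric by (intro exI[of _ d]) simp
qed

text \<open>Two integers have to be absorbed: the representative used by \<open>linear_near\<close>
  may differ from \<open>s\<close>, and the affine lift may differ from \<open>G\<close> by a
  constant.\<close>

lemma lift_affine_near:
  assumes G: "isCont G s" "\<And>z. f (to_circle z) = to_circle (G z)" and lin: "linear_near f (to_circle s)"
  obtains a d where "\<forall>\<^sub>F r in nhds s. G r = a * r + d"
proof -
  obtain t a b where t: "to_circle s = to_circle t" "\<forall>\<^sub>F r in nhds t. f (to_circle r) = to_circle (a * r + b)"
    using lin unfolding linear_near_def by blast
  obtain k :: int where k: "s - t = of_int k" using t(1) by (auto simp: to_circle_eq_iff elim: Ints_cases)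
  then have tz: "t + of_int k = s" by simp
  have "\<forall>\<^sub>F r in nhds s. f (to_circle (r - of_int k)) = to_circle (a * (r - of_int k) + b)"
    using eventually_nhds_shift[OF t(2), of "of_int k"] by (simp only: tz)
  moreover have "to_circle (r - of_int k) = to_circle r" for r
    using to_circle_add_of_int[of r "- k"] by simp
  ultimately have "\<forall>\<^sub>F r in nhds s. to_circle (G r) = to_circle (a * (r - of_int k) + b)"
    by (simp add: G(2))
  then have "\<forall>\<^sub>F r in nhds s. G r = a * (r - of_int k) + b + (G s - (a * (s - of_int k) + b))"
    using G(1) by (intro lifts_differ_by_constant) (auto intro!: continuous_intros)
  then have "\<forall>\<^sub>F r in nhds s. G r = a * r + (G s - a * s)"
    by eventually_elim (simp add: algebra_simps)
  then show ?thesis using that by blast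
qed

lemma lift_deriv:
  assumes G: "isCont G z" "\<And>z. f (to_circle z) = to_circle (G z)" and slope: "has_slope f (to_circle z) m"
  shows "(G has_real_derivative m) (at z)"
proof -
  obtain t F where t: "to_circle z = to_circle t" "\<forall>\<^sub>F s in nhds t. f (to_circle s) = to_circle (F s)"
    "(F has_real_derivative m) (at t)"
    using slope unfolding has_slope_def by blast
  obtain k :: int where k: "z - t = of_int k" using t(1) by (auto simp: to_circle_eq_iff elim: Ints_cases)
  define F' where "F' r = F (r - of_int k)" for r
  have tz: "t = z - of_int k" "t + of_int k = z" using k by simp_all
  have F'_eq: "F' = (\<lambda>r. F (r + - of_int k))" by (simp add: F'_def fun_eq_iff)
  have der: "(F' has_real_derivative m) (at z)"
    using t(3) DERIV_shift[of F m z "- of_int k"] unfolding F'_eq by (simp add: tz(1))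
  have "\<forall>\<^sub>F r in nhds z. f (to_circle (r - of_int k)) = to_circle (F (r - of_int k))"
    using eventually_nhds_shift[OF t(2), of "of_int k"] by (simp only: tz(2))
  moreover have "to_circle (r - of_int k) = to_circle r" for r
    using to_circle_add_of_int[of r "- k"] by simp
  ultimately have "\<forall>\<^sub>F r in nhds z. to_circle (G r) = to_circle (F' r)" by (simp add: G(2) F'_def)
  then have "\<forall>\<^sub>F r in nhds z. G r = F' r + (G z - F' z)"
    using G(1) DERIV_isCont[OF der] by (intro lifts_differ_by_constant)
  moreover have "((\<lambda>r. F' r + (G z - F' z)) has_real_derivative m) (at z)"
    using der by (auto intro!: derivative_eq_intros)
  ultimately show ?thesis using DERIV_cong_ev[of z z G "\<lambda>r. F' r + (G z - F' z)" m m] by simp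
qed

lemma affine_at_endpoint:
  fixes G :: "real \<Rightarrow> real"
  assumes "isCont G z" "F \<le> at z" "F \<noteq> bot" "\<forall>\<^sub>F r in F. G r = c * r + d"
  shows "G z = c * z + d"
proof -
  have "(G \<longlongrightarrow> G z) F" using assms(1,2) unfolding isCont_def by (rule tendsto_mono[rotated])
  moreover have "((\<lambda>r. c * r + d) \<longlongrightarrow> c * z + d) (at z)" by (intro tendsto_intros)
  then have "((\<lambda>r. c * r + d) \<longlongrightarrow> c * z + d) F" using assms(2) by (rule tendsto_mono[rotated])
  then have "(G \<longlongrightarrow> c * z + d) F" by (rule Lim_transform_eventually) (use assms(4) in \<open>auto elim: eventually_mono\<close>)
  ultimately show ?thesis using assms(3) by (rule tendsto_unique[rotated])
qed

lemma has_real_derivative_within_unique: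
  fixes f :: "real \<Rightarrow> real"
  assumes "(f has_real_derivative a) (at x within S)" "(f has_real_derivative b) (at x within S)"
    and "at x within S \<noteq> bot"
  shows "a = b"
  using assms unfolding has_field_derivative_iff by (metis tendsto_unique)

lemma has_field_derivative_transform_eventually:
  fixes f g :: "real \<Rightarrow> real"
  assumes "(f has_real_derivative a) (at x within S)" "\<forall>\<^sub>F y in at x within S. g y = f y" "g x = f x"
  shows "(g has_real_derivative a) (at x within S)"
proof -
  have "((\<lambda>y. (f y - f x) / (y - x)) \<longlongrightarrow> a) (at x within S)"
    using assms(1) by (simp add: has_field_derivative_iff)
  then have "((\<lambda>y. (g y - g x) / (y - x)) \<longlongrightarrow> a) (at x within S)"
    by (rule Lim_transform_eventually) (use assms(2,3) in \<open>auto elim: eventually_mono\<close>)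
  then show ?thesis by (simp add: has_field_derivative_iff)
qed

text \<open>Affine germs glue on either side of \<open>z\<close> and continuity adds
  \<open>z\<close> itself. The slope condition makes both slopes powers of \<open>2\<close>. If
  \<open>z\<close> is not dyadic, it is not a break, so a derivative exists at \<open>z\<close> and
  forces the two slopes to agree.\<close>

lemma T21_bar_lift_PL2:
  assumes T: "T21_bar UNIV f" and G: "dyadic_auto G" "\<And>z. f (to_circle z) = to_circle (G z)"
  shows "G \<in> PL2"
proof (rule PL2I[OF G(1)])
  fix z
  have cG: "isCont G x" for x by (rule dyadic_auto_isCont[OF G(1)])
  obtain V where V: "open V" "to_circle z \<in> V" "\<And>y. y \<in> V - {to_circle z} \<Longrightarrow> linear_near f y"
    using T unfolding T21_bar_def PL_on_def by (metis UNIV_I)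
  have "open (to_circle -` V)" using V(1) by (simp add: open_circle_def)
  then obtain e0 where e0: "e0 > 0" "\<And>s. dist s z < e0 \<Longrightarrow> to_circle s \<in> V"
    using V(2) by (force simp: open_dist)
  \<comment> \<open>A radius of at most \<open>1\<close> ensures that no other point of the open
    interval represents the same point of the circle as \<open>z\<close>.\<close>
  define e where "e = min e0 1"
  have e: "e > 0" "e \<le> e0" "e \<le> 1" using e0 by (auto simp: e_def)
  have loc: "\<exists>c d. \<forall>\<^sub>F r in nhds s. G r = c * r + d" if "s \<noteq> z" "dist s z < e" for s
  proof -
    have "to_circle s \<noteq> to_circle z"
    proof
      assume "to_circle s = to_circle z"
      then obtain k :: int where k: "s - z = of_int k" by (auto simp: to_circle_eq_iff elim: Ints_cases)
      then have "\<bar>of_int k :: real\<bar> < 1" using that(2) e by (simp add: dist_real_def)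
      then have "k = 0" by linarith
      then show False using k that(1) by simp
    qed
    then have "linear_near f (to_circle s)" using V(3) e0(2)[of s] that(2) e by auto
    then show ?thesis using lift_affine_near[OF cG G(2)] by metis
  qed
  have power: "\<exists>k::int. c = 2 powi k" if "\<forall>\<^sub>F r in nhds s. G r = c * r + d" for s c d
  proof -
    have "(G has_real_derivative c) (at s)"
      using DERIV_cong_ev[of s s G "\<lambda>r. c * r + d" c c] that by (auto intro!: derivative_eq_intros)
    then have "has_slope f (to_circle s) c" unfolding has_slope_def using G(2) by (intro exI[of _ s] exI[of _ G]) simp
    then show ?thesis using T unfolding T21_bar_def by blast
  qed
  obtain c d where cd: "\<And>s. z < s \<Longrightarrow> s < z + e \<Longrightarrow> G s = c * s + d"
    using locally_affine_imp_affine[of z "z + e" G] loc by (auto simp: dist_real_def)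
  obtain c' d' where cd': "\<And>s. z - e < s \<Longrightarrow> s < z \<Longrightarrow> G s = c' * s + d'"
    using locally_affine_imp_affine[of "z - e" z G] loc by (auto simp: dist_real_def)
  have "\<forall>\<^sub>F r in nhds (z + e / 2). G r = c * r + d"
    using eventually_nhds_in_open[of "{z<..<z + e}" "z + e / 2"] e(1) by (auto elim!: eventually_mono intro: cd)
  then obtain i where i: "c = 2 powi i" using power by blast
  have "\<forall>\<^sub>F r in nhds (z - e / 2). G r = c' * r + d'"
    using eventually_nhds_in_open[of "{z - e<..<z}" "z - e / 2"] e(1) by (auto elim!: eventually_mono intro: cd')
  then obtain j where j: "c' = 2 powi j" using power by blast
  have right: "\<forall>\<^sub>F r in at_right z. G r = c * r + d"
    unfolding eventually_at_right_field using e(1) cd by (intro exI[of _ "z + e"]) auto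
  have left: "\<forall>\<^sub>F r in at_left z. G r = c' * r + d'"
    unfolding eventually_at_left_field using e(1) cd' by (intro exI[of _ "z - e"]) auto
  have Gz: "G z = c * z + d" "G z = c' * z + d'"
    using affine_at_endpoint[OF cG at_le[of "{z<..}" UNIV z] _ right] affine_at_endpoint[OF cG at_le[of "{..<z}" UNIV z] _ left]
    by auto
  show "pl_at G z"
    unfolding pl_at_def
  proof (rule exI[of _ "e / 2"], intro conjI, use e(1) in simp, rule exI[of _ i], rule exI[of _ j], intro conjI ballI impI)
    fix t assume t: "t \<in> {0..e / 2}"
    show "G (z + t) = G z + 2 powi i * t"
      using cd[of "z + t"] Gz(1) t e(1) by (cases "t = 0") (auto simp: i distrib_left)
    show "G (z - t) = G z - 2 powi j * t"
      using cd'[of "z - t"] Gz(2) t e(1) by (cases "t = 0") (auto simp: j right_diff_distrib)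
  next
    assume "z \<notin> Dy"
    then have "\<not> is_break f (to_circle z)" using T unfolding T21_bar_def by (auto simp: to_circle_in_dyadic_iff)
    then obtain f' where "\<forall>\<^sub>F y in nhds (to_circle z). has_slope f y (f' y)" unfolding is_break_def by blast
    then have "has_slope f (to_circle z) (f' (to_circle z))" by (rule eventually_nhds_x_imp_x)
    then obtain m where m: "(G has_real_derivative m) (at z)" using lift_deriv[OF cG G(2)] by blast
    have "m = c"
    proof (rule has_real_derivative_within_unique)
      show "(G has_real_derivative m) (at_right z)" using m by (rule has_field_derivative_at_within)
      have "((\<lambda>r. c * r + d) has_real_derivative c) (at_right z)" by (auto intro!: derivative_eq_intros)
      then show "(G has_real_derivative c) (at_right z)"
        by (rule has_field_derivative_transform_eventually) (use right Gz(1) in \<open>auto elim: eventually_mono\<close>)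
    qed simp
    moreover have "m = c'"
    proof (rule has_real_derivative_within_unique)
      show "(G has_real_derivative m) (at_left z)" using m by (rule has_field_derivative_at_within)
      have "((\<lambda>r. c' * r + d') has_real_derivative c') (at_left z)" by (auto intro!: derivative_eq_intros)
      then show "(G has_real_derivative c') (at_left z)"
        by (rule has_field_derivative_transform_eventually) (use left Gz(2) in \<open>auto elim: eventually_mono\<close>)
    qed simp
    ultimately show "i = j" using powi2_inj i j by simp
  qed
qed

text \<open>On each open side of \<open>t\<close> the slope is constant, which rules out breaks
  there and gives linearity; only the centre itself may be a break.\<close>

lemma one_sided_affine_imp_PL:
  assumes cont: "continuous_on UNIV h" and H: "\<And>t. h (to_circle t) = to_circle (H t)"
    and aff: "\<And>x. \<exists>e>0. \<exists>a b. \<forall>t\<in>{0..e}. H (x + t) = H x + a * t \<and> H (x - t) = H x - b * t"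
  shows "PL_on UNIV h"
  unfolding PL_on_def
proof (intro conjI ballI)
  fix x
  obtain t where t: "x = to_circle t" by (rule to_circle_surj)
  obtain e a b where e: "e > 0"
    and ab: "\<And>s. s \<in> {0..e} \<Longrightarrow> H (t + s) = H t + a * s \<and> H (t - s) = H t - b * s"
    using aff[of t] by blast
  have off: "\<not> is_break h (to_circle s) \<and> linear_near h (to_circle s)" if s: "s \<in> {t - e<..<t + e}" "s \<noteq> t" for s
  proof -
    have "\<exists>c d. \<forall>\<^sub>F r in nhds s. H r = c * r + d"
    proof (cases "s < t")
      case True
      have "H r = b * r + (H t - b * t)" if "r \<in> {t - e<..<t}" for r
        using ab[of "t - r"] that by (auto simp: algebra_simps)
      then have eq: "\<And>r. r \<in> {t - e<..<t} \<Longrightarrow> H r = b * r + (H t - b * t)" by blast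
      have "\<forall>\<^sub>F r in nhds s. r \<in> {t - e<..<t}" using True s by (intro eventually_nhds_in_open) auto
      then have "\<forall>\<^sub>F r in nhds s. H r = b * r + (H t - b * t)" by eventually_elim (rule eq)
      then show ?thesis by blast
    next
      case False
      have "H r = a * r + (H t - a * t)" if "r \<in> {t<..<t + e}" for r
        using ab[of "r - t"] that by (auto simp: algebra_simps)
      then have eq: "\<And>r. r \<in> {t<..<t + e} \<Longrightarrow> H r = a * r + (H t - a * t)" by blast
      have "\<forall>\<^sub>F r in nhds s. r \<in> {t<..<t + e}" using False s by (intro eventually_nhds_in_open) auto
      then have "\<forall>\<^sub>F r in nhds s. H r = a * r + (H t - a * t)" by eventually_elim (rule eq)
      then show ?thesis by blast
    qed
    then obtain c d where cd: "\<forall>\<^sub>F r in nhds s. H r = c * r + d" by blast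
    then have lift: "\<forall>\<^sub>F r in nhds s. h (to_circle r) = to_circle (c * r + d)"
      by eventually_elim (simp add: H)
    have "has_slope h (to_circle r) c" if "\<forall>\<^sub>F u in nhds r. h (to_circle u) = to_circle (c * u + d)" for r
      unfolding has_slope_def
    proof (rule exI[of _ r], rule exI[of _ "\<lambda>u. c * u + d"], intro conjI that refl)
      show "((\<lambda>u. c * u + d) has_real_derivative c) (at r)" by (auto intro!: derivative_eq_intros)
    qed
    moreover have "\<forall>\<^sub>F r in nhds s. \<forall>\<^sub>F u in nhds r. h (to_circle u) = to_circle (c * u + d)"
      using lift by (simp add: eventually_eventually)
    ultimately have "\<forall>\<^sub>F r in nhds s. has_slope h (to_circle r) c" by (auto elim: eventually_mono)
    then have "\<forall>\<^sub>F y in nhds (to_circle s). has_slope h y c" by (simp add: eventually_nhds_to_circle)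
    then have "\<not> is_break h (to_circle s)" unfolding is_break_def by (auto intro!: exI[of _ "\<lambda>_. c"])
    moreover have "linear_near h (to_circle s)" unfolding linear_near_def using lift by blast
    ultimately show ?thesis by blast
  qed
  show "\<exists>V. open V \<and> x \<in> V \<and> V \<subseteq> UNIV \<and> (\<forall>y\<in>V - {x}. \<not> is_break h y \<and> linear_near h y)"
  proof (intro exI[of _ "to_circle ` {t - e<..<t + e}"] conjI ballI)
    show "open (to_circle ` {t - e<..<t + e})" by (rule open_to_circle_image) simp
    show "x \<in> to_circle ` {t - e<..<t + e}" using e t by auto
    fix y assume "y \<in> to_circle ` {t - e<..<t + e} - {x}"
    then obtain s where s: "s \<in> {t - e<..<t + e}" "y = to_circle s" "y \<noteq> x" by blast
    then have "s \<noteq> t" using t by auto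
    then show "\<not> is_break h y" "linear_near h y" using off[of s] s by auto
  qed simp
qed (rule cont)

lemma inv_to_circle:
  assumes "bij h" "dyadic_auto H" "\<And>t. h (to_circle t) = to_circle (H t)"
  shows "inv h (to_circle t) = to_circle (inv H t)"
proof -
  have "surj H" using assms(2) by (simp add: dyadic_auto_def)
  then have "h (to_circle (inv H t)) = to_circle t" using assms(3) by (simp add: surj_f_inv_f)
  then show ?thesis using assms(1) by (metis bij_inv_eq_iff)
qed

theorem theorem3:
  fixes h :: "circle \<Rightarrow> circle"
  assumes "homeomorphism UNIV UNIV h (inv h)"
    and "orientation_preserving_on UNIV h"
    and "h ` dyadic = dyadic"
    and "T21_bar UNIV (h \<circ> nu2 \<circ> inv h)"
    and "T21_bar UNIV (inv h \<circ> nu2 \<circ> h)"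
  shows "PL_on UNIV h"
proof -
  obtain H where H: "dyadic_auto H" "\<And>t. h (to_circle t) = to_circle (H t)" "\<And>t. H (t + 1) = H t + 1"
    using homeomorphism_lift[OF assms(1-3)] by blast
  have cont: "continuous_on UNIV h" and bij: "bij h"
    using assms(1) by (auto simp: homeomorphism_def bij_def intro: inj_on_inverseI[of _ "inv h"])
  note inv = inv_to_circle[OF bij H(1,2)]
  have double: "aff 1 0 t = 2 * t" for t by (simp add: aff_def)
  have "H \<circ> aff 1 0 \<circ> inv H \<in> PL2"
    by (rule T21_bar_lift_PL2[OF assms(4)])
      (simp_all add: H inv nu2_to_circle double dyadic_auto_comp dyadic_auto_inv PL2_dyadic_auto aff_PL2)
  moreover have "inv H \<circ> aff 1 0 \<circ> H \<in> PL2"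
    by (rule T21_bar_lift_PL2[OF assms(5)])
      (simp_all add: H inv nu2_to_circle double dyadic_auto_comp dyadic_auto_inv PL2_dyadic_auto aff_PL2)
  ultimately show ?thesis
    by (intro one_sided_affine_imp_PL[OF cont H(2)] periodic_normaliser_locally_affine H)
qed

end
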